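(* Suppose Assumptions 1 and 2 hold and that the deterministic step sizes satisfy $\sum_l\alpha_\omega^{(l)}=\infty$, $\sum_l(\alpha_\omega^{(l)})^2<\infty$, $\sum_l\alpha_\xi^{(l)}=\infty$, $\sum_l(\alpha_\xi^{(l)})^2<\infty$. Then with probability approaching one (as $n\to\infty$) the data are such that $\hat\omega$ and $\hat\xi$ exist and, conditionally on the data, the stochastic-gradient iterates satisfy $\omega_l\to\hat\omega$ and $\xi_l\to\hat\xi$ almost surely as $l\to\infty$.
   Context: Setup. $\mathcal{A}$ finite, $\beta\in(0,1)$. Data: $n$ i.i.d. individuals observed over a fixed number $T\ge2$ of periods, $(a_{it},x_{it})_{t=1}^T$, stationary Markov with time-invariant transitions; $\mathbb{P}$ is the common law of $(a,x,a',x')=(a_{it},x_{it},a_{i,t+1},x_{i,t+1})$, $\mathbb{E}$ its expectation, $\|f\|_2:=\mathbb{E}[f(a,x)^2]^{1/2}$, and $\mathbb{E}_n[f]:=(n(T-1))^{-1}\sum_{i}\sum_{t=1}^{T-1}f(a_{it},x_{it},a_{i,t+1},x_{i,t+1})$. $z$ is a known function; $h$ is the fixed point of $f\mapsto z+\beta\mathbb{E}[f(a',x')\mid a,x]$; $\eta(a,x)=\mathbb{P}(a\mid x)$, $e(a,x)=\gamma-\ln\eta(a,x)$ ($\gamma$ Euler's constant), $g$ the fixed point of $f\mapsto\beta\mathbb{E}[e(a',x')+f(a',x')\mid a,x]$. Basis vectors $\phi\in\mathbb{R}^{k_\phi}$, $r\in\mathbb{R}^{k_r}$; $P_\phi[f]:=\phi^\intercal\mathbb{E}[\phi\phi^\intercal]^{-1}\mathbb{E}[\phi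 f]$, similarly $P_r$. Assumption 1: (i) components of $\phi$ linearly independent, eigenvalues of $\mathbb{E}[\phi\phi^\intercal]$ bounded away from zero uniformly in $k_\phi$; (ii) components of $\phi$ bounded by $M$; (iii) $\|h-P_\phi h\|_2\le Ck_\phi^{-\alpha}$; (iv) compact domain and $|z|\le L$; (v) $k_\phi\to\infty$, $k_\phi^2/n\to0$. Assumption 2: the same conditions (i)–(v) with $r,k_r,g,e$ in place of $\phi,k_\phi,h,z$. Let $\hat\eta$ be a strictly positive estimate of $\eta$ computed from the data and held fixed, $e_{i,t+1}(\hat\eta):=\gamma-\ln\hat\eta(a_{i,t+1},x_{i,t+1})$, and $\hat\omega:=\mathbb{E}_n[\phi(\phi-\beta\phi')^\intercal]^{-1}\mathbb{E}_n[\phi z]$, $\hat\xi:=\mathbb{E}_n[r(r-\beta r')^\intercal]^{-1}\mathbb{E}_n[\beta r\,e(a',x';\hat\eta)]$ (primes denote evaluation at $(a',x')$). Stochastic gradient (TD learning) iterates: starting from arbitrary $\omega_0,\xi_0$, at each step $l$ draw $(i,t)$, $t\le T-1$, uniformly at random with replacement from the sample, independently across steps, and set $\omega_{l+1}=\omega_l+\alpha_\omega^{(l)}\big(z_{it}+\beta\phi_{i,t+1}^\intercal\omega_l-\phi_{it}^\intercal\omega_l\big)\phi_{it}$ and $\xi_{l+1}=\xi_l+\alpha_\xi^{(l)}\big(\beta e_{i,t+1}(\hat\eta)+\beta r_{i,t+1}^\intercal\xi_l-r_{it}^\intercal\xi_l\big)r_{it}$, where $\phi_{it}:=\phi(a_{it},x_{it})$,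 $z_{it}:=z(a_{it},x_{it})$, $r_{it}:=r(a_{it},x_{it})$. *)

theory Defs
  imports "HOL-Probability.Probability" "Jordan_Normal_Form.Matrix" "Jordan_Normal_Form.Char_Poly"
begin

definition stS :: "('a::finite \<times> 'x::euclidean_space) measure" where
  "stS = count_space UNIV \<Otimes>\<^sub>M borel"

text \<open>Inverse of a square matrix (meaningful when it is invertible).\<close>
definition minv :: "real mat \<Rightarrow> real mat" where
  "minv A = (THE B. B \<in> carrier_mat (dim_row A) (dim_row A) \<and> A * B = 1\<^sub>m (dim_row A)
                      \<and> B * A = 1\<^sub>m (dim_row A))"

definition fvec :: "nat \<Rightarrow> (nat \<Rightarrow> 's \<Rightarrow> real) \<Rightarrow> 's \<Rightarrow> real vec" where
  "fvec k f s = vec k (\<lambda>j. f j s)"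

definition gram :: "'s measure \<Rightarrow> nat \<Rightarrow> (nat \<Rightarrow> 's \<Rightarrow> real) \<Rightarrow> real mat" where
  "gram \<pi> k f = mat k k (\<lambda>(p,q). \<integral>s. f p s * f q s \<partial>\<pi>)"

definition proj :: "'s measure \<Rightarrow> nat \<Rightarrow> (nat \<Rightarrow> 's \<Rightarrow> real) \<Rightarrow> ('s \<Rightarrow> real) \<Rightarrow> 's \<Rightarrow> real" where
  "proj \<pi> k f u s = fvec k f s \<bullet> (minv (gram \<pi> k f) *\<^sub>v vec k (\<lambda>p. \<integral>s'. f p s' * u s' \<partial>\<pi>))"

definition l2norm :: "'s measure \<Rightarrow> ('s \<Rightarrow> real) \<Rightarrow> real" where
  "l2norm \<pi> u = sqrt (\<integral>s. (u s)\<^sup>2 \<partial>\<pi>)"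

text \<open>Nested integral giving the finite-dimensional distributions of a Markov chain
  with kernel K: fdd K B t m s = P(X_{t+1} in B(t+1),...,X_{t+m} in B(t+m) | X_t = s).\<close>
fun fdd :: "('s \<Rightarrow> 's measure) \<Rightarrow> (nat \<Rightarrow> 's set) \<Rightarrow> nat \<Rightarrow> nat \<Rightarrow> 's \<Rightarrow> real" where
  "fdd K B t 0 s = 1"
| "fdd K B t (Suc m) s = (\<integral>s'. indicator (B (Suc t)) s' * fdd K B (Suc t) m s' \<partial>(K s))"

definition En :: "nat \<Rightarrow> nat \<Rightarrow> (nat \<Rightarrow> nat \<Rightarrow> 's) \<Rightarrow> ('s \<Rightarrow> 's \<Rightarrow> real) \<Rightarrow> real" where
  "En T n D f = (\<Sum>i<n. \<Sum>t\<in>{1..T-1}. f (D i t) (D i (Suc t))) / (real n * (real T - 1))"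

definition tdmat :: "nat \<Rightarrow> nat \<Rightarrow> (nat \<Rightarrow> nat \<Rightarrow> 's) \<Rightarrow> real \<Rightarrow> nat \<Rightarrow> (nat \<Rightarrow> 's \<Rightarrow> real) \<Rightarrow> real mat" where
  "tdmat T n D \<beta> k f = mat k k (\<lambda>(p,q). En T n D (\<lambda>s s'. f p s * (f q s - \<beta> * f q s')))"

definition idxset :: "nat \<Rightarrow> nat \<Rightarrow> (nat \<times> nat) set" where
  "idxset T n = {(i,t). i < n \<and> 1 \<le> t \<and> t \<le> T - 1}"

definition drawM :: "nat \<Rightarrow> nat \<Rightarrow> (nat \<Rightarrow> nat \<times> nat) measure" where
  "drawM T n = (\<Pi>\<^sub>M l\<in>UNIV. measure_pmf (pmf_of_set (idxset T n)))"

primrec td :: "(nat \<Rightarrow> real) \<Rightarrow> real \<Rightarrow> (nat \<Rightarrow> nat \<Rightarrow> real vec) \<Rightarrow> (nat \<Rightarrow> nat \<Rightarrow> real)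
               \<Rightarrow> real vec \<Rightarrow> (nat \<Rightarrow> nat \<times> nat) \<Rightarrow> nat \<Rightarrow> real vec" where
  "td \<alpha> \<beta> F R w0 \<sigma> 0 = w0"
| "td \<alpha> \<beta> F R w0 \<sigma> (Suc l) =
     (let w = td \<alpha> \<beta> F R w0 \<sigma> l; i = fst (\<sigma> l); t = snd (\<sigma> l)
      in w + (\<alpha> l * (R i t + \<beta> * (F i (Suc t) \<bullet> w) - F i t \<bullet> w)) \<cdot>\<^sub>v F i t)"

end

theory Submission
  imports Defs
begin

text \<open>Conditionally on the data, TD learning is a linear stochastic approximation whose mean matrix is
  the sample matrix \<open>A\<close>.  If \<open>A\<close> is coercive, \<open>V(w) = |w - minv A b|\<^sup>2\<close> satisfies
  \<open>E V(w\<^sub>l\<^sub>+\<^sub>1) \<le> (1 - 2\<epsilon>\<alpha>\<^sub>l + C\<alpha>\<^sub>l\<^sup>2) V(w\<^sub>l) + C\<alpha>\<^sub>l\<^sup>2\<close> given the past.  This forces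
  \<open>E V(w\<^sub>N) \<rightarrow> 0\<close>, and Ville's inequality bounds the probability that \<open>V\<close> ever exceeds a fixed
  level after time \<open>N\<close> by a multiple of \<open>E V(w\<^sub>N)\<close> plus the tail \<open>C \<Sum>\<^sub>l\<^sub>\<ge>\<^sub>N \<alpha>\<^sub>l\<^sup>2\<close>; no
  martingale convergence theorem is needed.

  Coercivity holds with probability tending to one: by stationarity and
  \<open>2 u\<^sub>t u\<^sub>t\<^sub>+\<^sub>1 \<le> u\<^sub>t\<^sup>2 + u\<^sub>t\<^sub>+\<^sub>1\<^sup>2\<close> the expectation of \<open>A\<close> dominates \<open>1 - \<beta>\<close> times the Gram
  matrix, and the expected squared Frobenius distance of \<open>A\<close> from its expectation is \<open>O(k\<^sup>2/n)\<close>.\<close>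

subsection \<open>Almost sure convergence from a drift inequality\<close>

text \<open>Two sources of randomness are kept apart. On the data side the independent unit is the
  individual: the periods of one individual are dependent and their number is fixed, so variances
  are computed across individuals and no mixing enters. On the side of the draws the data are frozen
  and no filtration appears: an i.i.d. sequence is one draw followed by a fresh sequence, so each
  conditional expectation is an average over a finite index set, and the estimates become inductions
  on time with shifted step sizes. The additive term in the drift comes from the TD error at the
  limit. It does not vanish draw by draw, but it averages to zero against the basis functions
  because \<open>A w = b\<close> there; it therefore enters only at second order in the step size.
  The sample matrix is not symmetric, so its quadratic form is controlled rather than its spectrum;
  eigenvalues enter only through the symmetric Gram matrix.\<close>

primrec iterate :: "(real \<Rightarrow> 'i \<Rightarrow> 's \<Rightarrow> 's) \<Rightarrow> (nat \<Rightarrow> real) \<Rightarrow> 's \<Rightarrow> (nat \<Rightarrow> 'i) \<Rightarrow> nat \<Rightarrow> 's" where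
  "iterate G \<alpha> x \<sigma> 0 = x"
| "iterate G \<alpha> x \<sigma> (Suc l) = G (\<alpha> l) (\<sigma> l) (iterate G \<alpha> x \<sigma> l)"

text \<open>Deterministic majorant of the expected Lyapunov value: the drift inequality read as an
  equality.\<close>

primrec drift_bound :: "real \<Rightarrow> real \<Rightarrow> (nat \<Rightarrow> real) \<Rightarrow> real \<Rightarrow> nat \<Rightarrow> real" where
  "drift_bound \<epsilon> C \<alpha> v 0 = v"
| "drift_bound \<epsilon> C \<alpha> v (Suc l) =
     (1 - 2 * \<epsilon> * \<alpha> l + C * (\<alpha> l)\<^sup>2) * drift_bound \<epsilon> C \<alpha> v l + C * (\<alpha> l)\<^sup>2"

text \<open>This is why the step size is an argument of \<open>G\<close>: after the first draw the
  iteration is again of the same form, with \<open>\<alpha> \<circ> Suc\<close> as its step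
  sizes.\<close>

lemma iterate_case_nat:
  "iterate G \<alpha> x (case_nat s \<sigma>) (Suc l) = iterate G (\<alpha> \<circ> Suc) (G (\<alpha> 0) s x) \<sigma> l"
  by (induction l) auto

lemma drift_bound_shift:
  "drift_bound \<epsilon> C \<alpha> v (Suc l) =
   drift_bound \<epsilon> C (\<alpha> \<circ> Suc) ((1 - 2 * \<epsilon> * \<alpha> 0 + C * (\<alpha> 0)\<^sup>2) * v + C * (\<alpha> 0)\<^sup>2) l"
  by (induction l) auto

text \<open>Affine dependence on the start value lets the bound commute with the average over a
  draw; since the slope is nonnegative when \<open>\<epsilon>\<^sup>2 \<le> C\<close>, it also gives
  monotonicity.\<close>

lemma drift_bound_affine:
  "drift_bound \<epsilon> C \<alpha> v l =
   (\<Prod>j<l. 1 - 2 * \<epsilon> * \<alpha> j + C * (\<alpha> j)\<^sup>2) * v + drift_bound \<epsilon> C \<alpha> 0 l"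
  by (induction l) (auto simp: algebra_simps)

text \<open>Completing the square. The condition on \<open>C\<close> makes the factor nonnegative
  for every step size, large ones included, so no initial steps have to be discarded.\<close>

lemma drift_factor_nonneg:
  fixes a :: real
  assumes "\<epsilon>\<^sup>2 \<le> C"
  shows "0 \<le> 1 - 2 * \<epsilon> * a + C * a\<^sup>2"
proof -
  have "0 \<le> (1 - \<epsilon> * a)\<^sup>2" by simp
  also have "\<dots> = 1 - 2 * \<epsilon> * a + \<epsilon>\<^sup>2 * a\<^sup>2" by (simp add: power2_eq_square algebra_simps)
  also have "\<dots> \<le> 1 - 2 * \<epsilon> * a + C * a\<^sup>2" using assms by (simp add: mult_right_mono)
  finally show ?thesis .
qed

lemma drift_bound_mono:
  assumes "\<epsilon>\<^sup>2 \<le> C" "v \<le> w"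
  shows "drift_bound \<epsilon> C \<alpha> v l \<le> drift_bound \<epsilon> C \<alpha> w l"
  by (subst (1 2) drift_bound_affine)
     (auto intro!: mult_left_mono prod_nonneg drift_factor_nonneg assms)

lemma drift_bound_average:
  assumes "finite I" "I \<noteq> {}"
  shows "(\<Sum>s\<in>I. drift_bound \<epsilon> C \<alpha> (f s) l) / card I = drift_bound \<epsilon> C \<alpha> ((\<Sum>s\<in>I. f s) / card I) l"
proof -
  have c: "real (card I) \<noteq> 0" using assms by auto
  show ?thesis
    by (subst drift_bound_affine, subst (2) drift_bound_affine)
       (use c in \<open>simp add: sum.distrib sum_distrib_left[symmetric] add_divide_distrib\<close>)
qed

lemma drift_bound_nonneg:
  assumes "\<epsilon>\<^sup>2 \<le> C" "0 \<le> v"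
  shows "0 \<le> drift_bound \<epsilon> C \<alpha> v l"
  using assms drift_factor_nonneg[OF assms(1)] order_trans[OF zero_le_power2 assms(1)]
  by (induction l) auto

text \<open>Once \<open>C * \<alpha> l \<le> \<epsilon>\<close>, the factor is at most
  \<open>exp (- \<epsilon> * \<alpha> l)\<close>. Divergence of the step sizes then kills what is
  inherited from time \<open>N\<close>, while the noise added after \<open>N\<close> is at most
  \<open>C\<close> times a tail of the squares, which is below \<open>e / 2\<close> by the choice of
  \<open>N\<close>.\<close>

lemma drift_bound_tendsto_0:
  fixes \<alpha> :: "nat \<Rightarrow> real"
  assumes \<epsilon>: "0 < \<epsilon>" "\<epsilon>\<^sup>2 \<le> C" and v: "0 \<le> v" and nn: "\<And>l. 0 \<le> \<alpha> l"
    and div: "filterlim (\<lambda>m. \<Sum>l<m. \<alpha> l) at_top sequentially"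
    and sq: "summable (\<lambda>l. (\<alpha> l)\<^sup>2)"
  shows "drift_bound \<epsilon> C \<alpha> v \<longlonglongrightarrow> 0"
proof (rule LIMSEQ_I)
  fix e :: real assume e: "0 < e"
  have C: "0 < C" using \<epsilon> by (meson less_le_trans zero_less_power)
  have "(\<lambda>l. (\<alpha> l)\<^sup>2) \<longlonglongrightarrow> 0" using sq by (rule summable_LIMSEQ_zero)
  then have "(\<lambda>l. sqrt ((\<alpha> l)\<^sup>2)) \<longlonglongrightarrow> sqrt 0" by (rule tendsto_real_sqrt)
  then have a0: "\<alpha> \<longlonglongrightarrow> 0" using nn by simp
  have "\<forall>\<^sub>F l in sequentially. \<alpha> l < min (\<epsilon> / C) (1 / \<epsilon>)"
    using C \<epsilon> by (intro order_tendstoD(2)[OF a0]) auto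
  then obtain N1 where N1: "\<And>l. l \<ge> N1 \<Longrightarrow> \<alpha> l < min (\<epsilon> / C) (1 / \<epsilon>)"
    by (auto simp: eventually_sequentially)
  have "(\<lambda>m. \<Sum>l. (\<alpha> (l + m))\<^sup>2) \<longlonglongrightarrow> 0"
    using suminf_exist_split2[OF sq] .
  then have "\<forall>\<^sub>F m in sequentially. (\<Sum>l. (\<alpha> (l + m))\<^sup>2) < e / (2 * C)"
    using C e by (intro order_tendstoD(2)) auto
  then obtain N2 where N2: "\<And>m. m \<ge> N2 \<Longrightarrow> (\<Sum>l. (\<alpha> (l + m))\<^sup>2) < e / (2 * C)"
    by (auto simp: eventually_sequentially)
  define N where "N = max N1 N2"
  define u where "u = drift_bound \<epsilon> C \<alpha> v"
  have u: "0 \<le> u l" for l unfolding u_def using \<epsilon> v by (intro drift_bound_nonneg)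
  have step: "u (Suc l) \<le> exp (- \<epsilon> * \<alpha> l) * u l + C * (\<alpha> l)\<^sup>2" if "l \<ge> N" for l
  proof -
    have "\<alpha> l < \<epsilon> / C" using N1[of l] that by (simp add: N_def)
    then have "C * \<alpha> l \<le> \<epsilon>" using C by (simp add: field_simps)
    then have "C * \<alpha> l * \<alpha> l \<le> \<epsilon> * \<alpha> l" using nn by (intro mult_right_mono) auto
    then have "1 - 2 * \<epsilon> * \<alpha> l + C * (\<alpha> l)\<^sup>2 \<le> 1 + (- \<epsilon> * \<alpha> l)" by (simp add: power2_eq_square)
    also have "\<dots> \<le> exp (- \<epsilon> * \<alpha> l)" by (rule exp_ge_add_one_self)
    finally show ?thesis using u[of l] by (simp add: u_def mult_right_mono)
  qed
  have bnd: "u (N + m) \<le> exp (- \<epsilon> * (\<Sum>l<m. \<alpha> (l + N))) * u N + C * (\<Sum>l<m. (\<alpha> (l + N))\<^sup>2)" for m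
  proof (induction m)
    case 0 then show ?case by simp
  next
    case (Suc m)
    let ?x = "exp (- \<epsilon> * (\<Sum>l<m. \<alpha> (l + N))) * u N" and ?y = "C * (\<Sum>l<m. (\<alpha> (l + N))\<^sup>2)"
    let ?a = "\<alpha> (m + N)"
    have y: "0 \<le> ?y" using C by (intro mult_nonneg_nonneg sum_nonneg) auto
    have "u (N + Suc m) \<le> exp (- \<epsilon> * ?a) * u (N + m) + C * ?a\<^sup>2"
      using step[of "N + m"] by (simp add: add.commute)
    also have "\<dots> \<le> exp (- \<epsilon> * ?a) * (?x + ?y) + C * ?a\<^sup>2"
      using Suc by (simp add: mult_left_mono)
    also have "\<dots> \<le> exp (- \<epsilon> * ?a) * ?x + ?y + C * ?a\<^sup>2"
    proof -
      have "exp (- \<epsilon> * ?a) * ?y \<le> 1 * ?y" using y \<epsilon> nn by (intro mult_right_mono) auto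
      then show ?thesis by (simp add: distrib_left)
    qed
    also have "\<dots> = exp (- \<epsilon> * (\<Sum>l<Suc m. \<alpha> (l + N))) * u N + C * (\<Sum>l<Suc m. (\<alpha> (l + N))\<^sup>2)"
      by (simp add: distrib_left exp_add exp_diff exp_minus field_simps)
    finally show ?case .
  qed
  have tail: "C * (\<Sum>l<m. (\<alpha> (l + N))\<^sup>2) < e / 2" for m
  proof -
    have "(\<Sum>l<m. (\<alpha> (l + N))\<^sup>2) \<le> (\<Sum>l. (\<alpha> (l + N))\<^sup>2)"
      using sq by (intro sum_le_suminf summable_ignore_initial_segment) auto
    also have "\<dots> < e / (2 * C)" by (rule N2) (simp add: N_def)
    finally show ?thesis using C by (simp add: field_simps)
  qed
  have "filterlim (\<lambda>m. \<Sum>l<m + N. \<alpha> l) at_top sequentially"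
    using div by (rule filterlim_compose) (rule filterlim_add_const_nat_at_top)
  then have "filterlim (\<lambda>m. - (\<Sum>l<N. \<alpha> l) + (\<Sum>l<m + N. \<alpha> l)) at_top sequentially"
    by (rule filterlim_tendsto_add_at_top[OF tendsto_const])
  moreover have "- (\<Sum>l<N. \<alpha> l) + (\<Sum>l<m + N. \<alpha> l) = (\<Sum>l<m. \<alpha> (l + N))" for m
    by (induction m) auto
  ultimately have "filterlim (\<lambda>m. \<Sum>l<m. \<alpha> (l + N)) at_top sequentially" by simp
  then have "filterlim (\<lambda>m. - \<epsilon> * (\<Sum>l<m. \<alpha> (l + N))) at_bot sequentially"
    using \<epsilon> by (intro filterlim_tendsto_neg_mult_at_bot[OF tendsto_const]) auto
  then have "(\<lambda>m. exp (- \<epsilon> * (\<Sum>l<m. \<alpha> (l + N))) * u N) \<longlonglongrightarrow> 0 * u N"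
    by (intro tendsto_mult tendsto_const filterlim_compose[OF exp_at_bot])
  then have "\<forall>\<^sub>F m in sequentially. exp (- \<epsilon> * (\<Sum>l<m. \<alpha> (l + N))) * u N < e / 2"
    using e by (intro order_tendstoD(2)) auto
  then obtain N3 where N3: "\<And>m. m \<ge> N3 \<Longrightarrow> exp (- \<epsilon> * (\<Sum>l<m. \<alpha> (l + N))) * u N < e / 2"
    by (auto simp: eventually_sequentially)
  have "norm (u l - 0) < e" if "l \<ge> N + N3" for l
  proof -
    define m where "m = l - N"
    have m: "l = N + m" "m \<ge> N3" using that by (auto simp: m_def)
    show ?thesis using bnd[of m] tail[of m] N3[OF m(2)] u[of l] by (simp add: m)
  qed
  then show "\<exists>no. \<forall>l\<ge>no. norm (drift_bound \<epsilon> C \<alpha> v l - 0) < e" unfolding u_def by blast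
qed

text \<open>The event of exceeding a level infinitely often lies in every tail event, so it is null
  as soon as \<open>b\<close> tends to zero; unlike in Borel-Cantelli, \<open>b\<close> is not
  summed. Countably many levels suffice.\<close>

lemma (in prob_space) AE_tendsto_0_tail_bound:
  fixes X :: "nat \<Rightarrow> 'a \<Rightarrow> real"
  assumes X [measurable]: "\<And>l. X l \<in> borel_measurable M" and nn: "\<And>l \<omega>. 0 \<le> X l \<omega>"
    and bound: "\<And>r N. 0 < r \<Longrightarrow> prob {\<omega> \<in> space M. \<exists>j\<ge>N. r \<le> X j \<omega>} \<le> b N / r"
    and b: "b \<longlonglongrightarrow> 0"
  shows "AE \<omega> in M. (\<lambda>l. X l \<omega>) \<longlonglongrightarrow> 0"
proof -
  have "AE \<omega> in M. \<exists>N. \<forall>j\<ge>N. X j \<omega> < inverse (real (Suc k))" for k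
  proof -
    define r where "r = inverse (real (Suc k))"
    have r: "0 < r" by (simp add: r_def)
    define U where "U N = {\<omega> \<in> space M. \<exists>j\<ge>N. r \<le> X j \<omega>}" for N
    have U: "U N \<in> events" for N unfolding U_def by measurable
    have Z: "(\<Inter>N. U N) \<in> events" using U by (intro sets.countable_INT) auto
    have "prob (\<Inter>N. U N) \<le> b N / r" for N
    proof -
      have "prob (\<Inter>N. U N) \<le> prob (U N)" using U by (intro finite_measure_mono) auto
      then show ?thesis using bound[OF r, of N] unfolding U_def by linarith
    qed
    moreover have "(\<lambda>N. b N / r) \<longlonglongrightarrow> 0 / r" using b r by (intro tendsto_divide tendsto_const) auto
    ultimately have "prob (\<Inter>N. U N) \<le> 0"
      by (intro LIMSEQ_le_const[where X = "\<lambda>N. b N / r"]) auto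
    then have "AE \<omega> in M. \<omega> \<notin> (\<Inter>N. U N)"
      using Z by (intro AE_not_in null_setsI) (auto simp: emeasure_eq_measure measure_le_0_iff)
    then show ?thesis using AE_space
    proof eventually_elim
      case (elim \<omega>)
      then obtain N where "\<omega> \<notin> U N" by blast
      then have "\<forall>j\<ge>N. X j \<omega> < r" using elim(2) by (force simp: U_def not_le[symmetric])
      then show ?case unfolding r_def by blast
    qed
  qed
  then have "AE \<omega> in M. \<forall>k. \<exists>N. \<forall>j\<ge>N. X j \<omega> < inverse (real (Suc k))"
    by (simp add: AE_all_countable)
  then show ?thesis
  proof eventually_elim
    case (elim \<omega>)
    show ?case
    proof (rule LIMSEQ_I)
      fix e :: real assume "0 < e"
      then obtain k where k: "inverse (real (Suc k)) < e" using reals_Archimedean by blast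
      obtain N where N: "\<And>j. j \<ge> N \<Longrightarrow> X j \<omega> < inverse (real (Suc k))" using elim by blast
      have "norm (X j \<omega> - 0) < e" if "j \<ge> N" for j
        using less_trans[OF N[OF that] k] nn[of j \<omega>] by simp
      then show "\<exists>no. \<forall>l\<ge>no. norm (X l \<omega> - 0) < e" by blast
    qed
  qed
qed

lemma average_affine:
  fixes f :: "'i \<Rightarrow> real"
  assumes "finite I" "I \<noteq> {}"
  shows "(\<Sum>s\<in>I. (f s + q) * e / r) / card I = ((\<Sum>s\<in>I. f s) / card I + q) * e / r"
proof -
  have c: "real (card I) \<noteq> 0" using assms by auto
  have "(\<Sum>s\<in>I. (f s + q) * e / r) = ((\<Sum>s\<in>I. f s) + card I * q) * (e / r)"
    by (simp add: sum.distrib sum_distrib_right[symmetric] sum_divide_distrib[symmetric])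
  also have "\<dots> / card I = (((\<Sum>s\<in>I. f s) + card I * q) / card I) * e / r"
    by simp
  also have "((\<Sum>s\<in>I. f s) + card I * q) / card I = (\<Sum>s\<in>I. f s) / card I + q"
    using c by (simp add: add_divide_distrib)
  finally show ?thesis .
qed

section \<open>Maximal inequality for iterations driven by i.i.d. draws from a finite set\<close>

locale finite_draws =
  fixes I :: "'i::countable set"
  assumes I: "finite I" "I \<noteq> {}"
begin

abbreviation draws :: "(nat \<Rightarrow> 'i) measure" where
  "draws \<equiv> \<Pi>\<^sub>M l\<in>UNIV. measure_pmf (pmf_of_set I)"

sublocale draw: sequence_space "measure_pmf (pmf_of_set I)" ..

text \<open>States carry the discrete sigma-algebra, which makes every map \<open>G\<close>
  admissible: for a fixed draw the step is a map out of \<open>count_space\<close>, and there are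
  only countably many possible draws.\<close>

lemma measurable_iterate [measurable]:
  "(\<lambda>\<sigma>. iterate G \<alpha> x \<sigma> l) \<in> draws \<rightarrow>\<^sub>M count_space UNIV"
proof (induction l)
  case (Suc l)
  have "(\<lambda>\<sigma>. \<sigma> l) \<in> draws \<rightarrow>\<^sub>M measure_pmf (pmf_of_set I)"
    by (rule measurable_component_singleton) simp
  then have "(\<lambda>\<sigma>. \<sigma> l) \<in> draws \<rightarrow>\<^sub>M count_space UNIV"
    by (simp only: measurable_cong_sets[OF refl sets_measure_pmf_count_space])
  moreover have "(\<lambda>\<sigma>. G (\<alpha> l) i (iterate G \<alpha> x \<sigma> l)) \<in> draws \<rightarrow>\<^sub>M count_space UNIV" for i
    using Suc by (rule measurable_compose) (rule measurable_count_space)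
  ultimately show ?case
    unfolding iterate.simps
    by (rule measurable_compose_countable[where f = "\<lambda>i \<sigma>. G (\<alpha> l) i (iterate G \<alpha> x \<sigma> l)", rotated])
qed simp

text \<open>By \<open>PiM_iter\<close>, prepending an independent draw to the sequence reproduces
  its law; Fubini then turns conditioning on the first draw into a finite average.\<close>

lemma prob_first_step:
  assumes A [measurable]: "A \<in> sets draws"
  shows "measure draws A = (\<Sum>s\<in>I. measure draws {\<sigma> \<in> space draws. case_nat s \<sigma> \<in> A}) / card I"
proof -
  let ?p = "measure_pmf (pmf_of_set I)"
  have sp: "space draws = UNIV" by (simp add: space_PiM)
  interpret pp: pair_prob_space ?p draws ..
  have cn [measurable]: "(\<lambda>(s, \<sigma>). case_nat s \<sigma>) \<in> ?p \<Otimes>\<^sub>M draws \<rightarrow>\<^sub>M draws" by measurable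
  have "measure draws A = measure (distr (?p \<Otimes>\<^sub>M draws) draws (\<lambda>(s, \<sigma>). case_nat s \<sigma>)) A"
    by (simp add: draw.PiM_iter)
  also have "\<dots> = measure (?p \<Otimes>\<^sub>M draws) ((\<lambda>(s, \<sigma>). case_nat s \<sigma>) -` A \<inter> space (?p \<Otimes>\<^sub>M draws))" (is "_ = measure _ ?B")
    by (rule measure_distr) measurable
  also have "\<dots> = (\<integral>s. measure draws (Pair s -` ?B) \<partial>?p)"
  proof -
    have "?B \<in> sets (?p \<Otimes>\<^sub>M draws)" using cn A by (rule measurable_sets)
    then have "emeasure (?p \<Otimes>\<^sub>M draws) ?B = (\<integral>\<^sup>+s. emeasure draws (Pair s -` ?B) \<partial>?p)"
      by (rule draw.P.emeasure_pair_measure_alt)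
    then have "ennreal (measure (?p \<Otimes>\<^sub>M draws) ?B) = (\<integral>\<^sup>+s. ennreal (measure draws (Pair s -` ?B)) \<partial>?p)"
      by (simp only: pp.emeasure_eq_measure draw.P.emeasure_eq_measure)
    also have "\<dots> = ennreal (\<integral>s. measure draws (Pair s -` ?B) \<partial>?p)"
      by (intro nn_integral_eq_integral measure_pmf.integrable_const_bound[of _ 1] AE_I2) auto
    finally show ?thesis by (subst (asm) ennreal_inj) (auto intro!: integral_nonneg_AE)
  qed
  also have "\<dots> = (\<integral>s. measure draws {\<sigma> \<in> space draws. case_nat s \<sigma> \<in> A} \<partial>?p)"
    by (intro Bochner_Integration.integral_cong refl arg_cong[where f = "measure draws"])
       (auto simp: space_pair_measure sp)
  also have "\<dots> = (\<Sum>s\<in>I. measure draws {\<sigma> \<in> space draws. case_nat s \<sigma> \<in> A}) / card I"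
    by (rule integral_pmf_of_set) (use I in auto)
  finally show ?thesis .
qed

lemma space_draws: "space draws = UNIV"
  by (simp add: space_PiM)

lemma sets_iterate:
  "{\<sigma>. \<exists>j\<le>m. Q (iterate G \<alpha> x \<sigma> (j + N))} \<in> sets draws"
proof -
  have "{\<sigma>. \<exists>j\<le>m. Q (iterate G \<alpha> x \<sigma> (j + N))} =
      (\<Union>j\<in>{..m}. (\<lambda>\<sigma>. iterate G \<alpha> x \<sigma> (j + N)) -` Collect Q \<inter> space draws)"
    by (auto simp: space_draws)
  also have "\<dots> \<in> sets draws"
    by (intro sets.finite_UN measurable_sets[OF measurable_iterate]) auto
  finally show ?thesis .
qed

text \<open>The iterates started at time \<open>N\<close> form a chain whose Lyapunov function \<open>V\<close>, corrected by the
  step-size tail, is a nonnegative supermartingale up to the factor \<open>exp\<close>.  The case \<open>N = 0\<close> is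
  Ville's maximal inequality; larger \<open>N\<close> follow by conditioning on the first draw.\<close>

context
  fixes G :: "real \<Rightarrow> 'i \<Rightarrow> 's \<Rightarrow> 's" and S :: "'s set" and V :: "'s \<Rightarrow> real" and \<epsilon> C :: real
  assumes G: "\<And>a s x. x \<in> S \<Longrightarrow> G a s x \<in> S"
    and V: "\<And>x. 0 \<le> V x"
    and \<epsilon>: "0 < \<epsilon>" "\<epsilon>\<^sup>2 \<le> C"
    and drift: "\<And>a x. 0 \<le> a \<Longrightarrow> x \<in> S \<Longrightarrow>
      (\<Sum>s\<in>I. V (G a s x)) / card I \<le> (1 - 2 * \<epsilon> * a + C * a\<^sup>2) * V x + C * a\<^sup>2"
begin

lemma maximal_ineq_0:
  assumes "0 < r" "x \<in> S" "\<And>l. 0 \<le> \<alpha> l"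
  shows "measure draws {\<sigma>. \<exists>j\<le>m. r \<le> V (iterate G \<alpha> x \<sigma> j)}
    \<le> (V x + C * (\<Sum>l<m. (\<alpha> l)\<^sup>2)) * exp (C * (\<Sum>l<m. (\<alpha> l)\<^sup>2)) / r"
  using assms(2,3)
proof (induction m arbitrary: \<alpha> x)
  case 0
  show ?case
  proof (cases "r \<le> V x")
    case True
    then have "1 \<le> V x / r" using assms(1) by simp
    then show ?thesis using order_trans[OF draw.P.prob_le_1] by simp
  qed (use V assms(1) in auto)
next
  case (Suc m)
  have C: "0 \<le> C" using \<epsilon> by (meson order_trans zero_le_power2)
  let ?q = "C * (\<Sum>l<m. (\<alpha> (Suc l))\<^sup>2)" and ?a = "\<alpha> 0"
  have q: "0 \<le> ?q" using C by (intro mult_nonneg_nonneg sum_nonneg) auto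
  have eq: "C * (\<Sum>l<Suc m. (\<alpha> l)\<^sup>2) = C * ?a\<^sup>2 + ?q"
    unfolding sum.lessThan_Suc_shift by (simp add: algebra_simps)
  show ?case
  proof (cases "r \<le> V x")
    \<comment> \<open>The claimed bound is at least 1 here, so it holds trivially.\<close>
    case True
    have "0 \<le> C * ?a\<^sup>2" using C by simp
    then have le: "r \<le> V x + (C * ?a\<^sup>2 + ?q)" and "0 \<le> C * ?a\<^sup>2 + ?q" using True q by linarith+
    then have "r * 1 \<le> (V x + (C * ?a\<^sup>2 + ?q)) * exp (C * ?a\<^sup>2 + ?q)"
      using assms(1) by (intro mult_mono) auto
    then have "1 \<le> (V x + (C * ?a\<^sup>2 + ?q)) * exp (C * ?a\<^sup>2 + ?q) / r" using assms(1) by simp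
    then show ?thesis unfolding eq using draw.P.prob_le_1 by (rule order_trans[rotated])
  next
    case False
    let ?A = "{\<sigma>. \<exists>j\<le>Suc m. r \<le> V (iterate G \<alpha> x \<sigma> j)}"
    have A: "?A \<in> sets draws" using sets_iterate[of "Suc m" "\<lambda>y. r \<le> V y" G \<alpha> x 0] by simp
    have ex_Suc: "(\<exists>j\<le>Suc m. Q j) \<longleftrightarrow> Q 0 \<or> (\<exists>j\<le>m. Q (Suc j))" for Q :: "nat \<Rightarrow> bool"
      by (simp only: less_Suc_eq_le[symmetric] Nat.Ex_less_Suc2)
    \<comment> \<open>Time 0 can be left out of the event because \<open>V x < r\<close> in this
      branch; the remaining times are those of the shifted iteration.\<close>
    have shift: "{\<sigma> \<in> space draws. case_nat s \<sigma> \<in> ?A} =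
        {\<sigma>. \<exists>j\<le>m. r \<le> V (iterate G (\<alpha> \<circ> Suc) (G ?a s x) \<sigma> j)}" for s
      using False unfolding ex_Suc by (simp del: iterate.simps(2) add: iterate_case_nat space_draws)
    have "measure draws ?A =
        (\<Sum>s\<in>I. measure draws {\<sigma>. \<exists>j\<le>m. r \<le> V (iterate G (\<alpha> \<circ> Suc) (G ?a s x) \<sigma> j)}) / card I"
      unfolding prob_first_step[OF A] shift ..
    also have "\<dots> \<le> (\<Sum>s\<in>I. (V (G ?a s x) + ?q) * exp ?q / r) / card I"
    proof (intro divide_right_mono sum_mono of_nat_0_le_iff)
      fix s
      have "measure draws {\<sigma>. \<exists>j\<le>m. r \<le> V (iterate G (\<alpha> \<circ> Suc) (G ?a s x) \<sigma> j)}
          \<le> (V (G ?a s x) + C * (\<Sum>l<m. ((\<alpha> \<circ> Suc) l)\<^sup>2)) * exp (C * (\<Sum>l<m. ((\<alpha> \<circ> Suc) l)\<^sup>2)) / r"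
        by (rule Suc.IH) (simp_all only: o_apply G[OF Suc.prems(1)] Suc.prems(2))
      then show "measure draws {\<sigma>. \<exists>j\<le>m. r \<le> V (iterate G (\<alpha> \<circ> Suc) (G ?a s x) \<sigma> j)}
          \<le> (V (G ?a s x) + ?q) * exp ?q / r"
        by (simp only: o_apply)
    qed
    also have "\<dots> = ((\<Sum>s\<in>I. V (G ?a s x)) / card I + ?q) * exp ?q / r"
    by (rule average_affine[OF I])
    also have "\<dots> \<le> ((V x + C * ?a\<^sup>2 + ?q) * (1 + C * ?a\<^sup>2)) * exp ?q / r"
    proof (intro divide_right_mono mult_right_mono)
      have "(\<Sum>s\<in>I. V (G ?a s x)) / card I \<le> (1 - 2 * \<epsilon> * ?a + C * ?a\<^sup>2) * V x + C * ?a\<^sup>2"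
        using Suc.prems by (intro drift)
      \<comment> \<open>The contraction term is given up: after the starting time only growth has to
        be limited.\<close>
      also have "\<dots> \<le> (1 + C * ?a\<^sup>2) * V x + C * ?a\<^sup>2"
        using \<epsilon> V Suc.prems by (intro add_right_mono mult_right_mono) auto
      finally have "(\<Sum>s\<in>I. V (G ?a s x)) / card I + ?q \<le> (1 + C * ?a\<^sup>2) * V x + C * ?a\<^sup>2 + ?q" by simp
      also have "\<dots> \<le> (V x + C * ?a\<^sup>2 + ?q) * (1 + C * ?a\<^sup>2)"
      proof -
        have "(1 + d) * v + d + w \<le> (v + d + w) * (1 + d)" if "0 \<le> d" "0 \<le> w" for d v w :: real
        proof -
          have "0 \<le> d * (d + w)" using that by simp
          then show ?thesis by (simp add: algebra_simps)
        qed
        then show ?thesis using q C by simp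
      qed
      finally show "(\<Sum>s\<in>I. V (G ?a s x)) / card I + ?q \<le> (V x + C * ?a\<^sup>2 + ?q) * (1 + C * ?a\<^sup>2)" .
    qed (use assms(1) in auto)
    \<comment> \<open>Replacing \<open>1 + C * ?a\<^sup>2\<close> by its exponential makes the
      growth factors of successive steps add up in the exponent.\<close>
    also have "\<dots> \<le> ((V x + C * ?a\<^sup>2 + ?q) * exp (C * ?a\<^sup>2)) * exp ?q / r"
      using q C V[of x] assms(1) by (intro divide_right_mono mult_right_mono mult_left_mono exp_ge_add_one_self) auto
    also have "\<dots> = (V x + (C * ?a\<^sup>2 + ?q)) * exp (C * ?a\<^sup>2 + ?q) / r"
      by (simp add: exp_add add.assoc)
    finally show ?thesis unfolding eq .
  qed
qed

lemma maximal_ineq: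
  assumes "0 < r" "x \<in> S" "\<And>l. 0 \<le> \<alpha> l"
  shows "measure draws {\<sigma>. \<exists>j\<le>m. r \<le> V (iterate G \<alpha> x \<sigma> (j + N))}
    \<le> (drift_bound \<epsilon> C \<alpha> (V x) N + C * (\<Sum>l<m. (\<alpha> (l + N))\<^sup>2)) * exp (C * (\<Sum>l<m. (\<alpha> (l + N))\<^sup>2)) / r"
  using assms(2,3)
proof (induction N arbitrary: \<alpha> x)
  case 0
  show ?case unfolding drift_bound.simps add_0_right by (rule maximal_ineq_0[OF assms(1) "0.prems"])
next
  case (Suc N)
  let ?q = "C * (\<Sum>l<m. (\<alpha> (l + Suc N))\<^sup>2)" and ?a = "\<alpha> 0"
  let ?d = "drift_bound \<epsilon> C (\<alpha> \<circ> Suc)"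
  let ?A = "{\<sigma>. \<exists>j\<le>m. r \<le> V (iterate G \<alpha> x \<sigma> (j + Suc N))}"
  have A: "?A \<in> sets draws" by (rule sets_iterate)
  have shift: "{\<sigma> \<in> space draws. case_nat s \<sigma> \<in> ?A} =
      {\<sigma>. \<exists>j\<le>m. r \<le> V (iterate G (\<alpha> \<circ> Suc) (G ?a s x) \<sigma> (j + N))}" for s
    by (simp del: iterate.simps add: iterate_case_nat space_draws)
  have "measure draws ?A =
      (\<Sum>s\<in>I. measure draws {\<sigma>. \<exists>j\<le>m. r \<le> V (iterate G (\<alpha> \<circ> Suc) (G ?a s x) \<sigma> (j + N))}) / card I"
    unfolding prob_first_step[OF A] shift ..
  also have "\<dots> \<le> (\<Sum>s\<in>I. (?d (V (G ?a s x)) N + ?q) * exp ?q / r) / card I"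
  proof (intro divide_right_mono sum_mono of_nat_0_le_iff)
    fix s
    have "measure draws {\<sigma>. \<exists>j\<le>m. r \<le> V (iterate G (\<alpha> \<circ> Suc) (G ?a s x) \<sigma> (j + N))}
        \<le> (?d (V (G ?a s x)) N + C * (\<Sum>l<m. ((\<alpha> \<circ> Suc) (l + N))\<^sup>2)) *
          exp (C * (\<Sum>l<m. ((\<alpha> \<circ> Suc) (l + N))\<^sup>2)) / r"
      by (rule Suc.IH) (simp_all only: o_apply G[OF Suc.prems(1)] Suc.prems(2))
    then show "measure draws {\<sigma>. \<exists>j\<le>m. r \<le> V (iterate G (\<alpha> \<circ> Suc) (G ?a s x) \<sigma> (j + N))}
        \<le> (?d (V (G ?a s x)) N + ?q) * exp ?q / r"
      by (simp only: o_apply add_Suc_right)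
  qed
  also have "\<dots> = ((\<Sum>s\<in>I. ?d (V (G ?a s x)) N) / card I + ?q) * exp ?q / r"
  by (rule average_affine[OF I])
  \<comment> \<open>The average over the draw moves into the start value by affinity; there the
    drift inequality applies once, and monotonicity carries it through the remaining
    \<open>N\<close> steps. Contraction is kept up to time \<open>N\<close>, which is what makes the
    bound small.\<close>
  also have "\<dots> \<le> (drift_bound \<epsilon> C \<alpha> (V x) (Suc N) + ?q) * exp ?q / r"
    unfolding drift_bound_average[OF I] drift_bound_shift using assms(1) Suc.prems
    by (intro divide_right_mono mult_right_mono add_right_mono drift_bound_mono \<epsilon> drift) auto
  finally show ?case .
qed

lemma iterate_AE_tendsto:
  assumes x: "x \<in> S" and \<alpha>: "\<And>l. 0 \<le> \<alpha> l"
    and div: "filterlim (\<lambda>m. \<Sum>l<m. \<alpha> l) at_top sequentially"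
    and sq: "summable (\<lambda>l. (\<alpha> l)\<^sup>2)"
  shows "AE \<sigma> in draws. (\<lambda>l. V (iterate G \<alpha> x \<sigma> l)) \<longlonglongrightarrow> 0"
proof -
  have C: "0 \<le> C" using \<epsilon> by (meson order_trans zero_le_power2)
  let ?B = "\<lambda>r N m. {\<sigma>. \<exists>j\<le>m. r \<le> V (iterate G \<alpha> x \<sigma> (j + N))}"
  let ?U = "\<lambda>r N. {\<sigma>. \<exists>j\<ge>N. r \<le> V (iterate G \<alpha> x \<sigma> j)}"
  have Bs: "?B r N m \<in> sets draws" for r N m by (rule sets_iterate)
  define q where "q N = C * (\<Sum>l. (\<alpha> (l + N))\<^sup>2)" for N
  define d where "d = drift_bound \<epsilon> C \<alpha> (V x)"
  have d0: "d \<longlonglongrightarrow> 0" unfolding d_def by (intro drift_bound_tendsto_0 \<epsilon> V \<alpha> div sq)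
  have "q \<longlonglongrightarrow> C * 0" unfolding q_def by (intro tendsto_mult tendsto_const suminf_exist_split2 sq)
  then have q0: "q \<longlonglongrightarrow> 0" by simp
  have U: "measure draws (?U r N) \<le> (d N + q N) * exp (q N) / r" if r: "0 < r" for r N
  proof -
    \<comment> \<open>Continuity from below removes the horizon \<open>m\<close>; the bound survives
      because \<open>q N\<close> dominates all the partial sums.\<close>
    have lim: "(\<lambda>m. measure draws (?B r N m)) \<longlonglongrightarrow> measure draws (\<Union>m. ?B r N m)"
    proof (rule draw.P.finite_Lim_measure_incseq)
      show "range (?B r N) \<subseteq> sets draws" using Bs by (rule image_subsetI)
      show "incseq (?B r N)" unfolding incseq_def by (blast intro: order_trans)
    qed
    moreover have "measure draws (?B r N m) \<le> (d N + q N) * exp (q N) / r" for m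
    proof -
      have "C * (\<Sum>l<m. (\<alpha> (l + N))\<^sup>2) \<le> q N" unfolding q_def
        using sq C by (intro mult_left_mono sum_le_suminf summable_ignore_initial_segment) auto
      moreover have "0 \<le> C * (\<Sum>l<m. (\<alpha> (l + N))\<^sup>2)" using C by (simp add: sum_nonneg)
      moreover have "0 \<le> d N" unfolding d_def by (intro drift_bound_nonneg \<epsilon> V)
      ultimately have "(d N + C * (\<Sum>l<m. (\<alpha> (l + N))\<^sup>2)) * exp (C * (\<Sum>l<m. (\<alpha> (l + N))\<^sup>2)) / r
          \<le> (d N + q N) * exp (q N) / r"
        using r by (intro divide_right_mono mult_mono) auto
      with maximal_ineq[where \<alpha> = \<alpha> and m = m and N = N, OF r x \<alpha>] show ?thesis unfolding d_def by linarith
    qed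
    moreover have eq: "(\<Union>m. ?B r N m) = ?U r N"
    proof (intro equalityI subsetI)
      fix \<sigma> assume "\<sigma> \<in> ?U r N"
      then obtain j where "j \<ge> N" "r \<le> V (iterate G \<alpha> x \<sigma> j)" by blast
      then have "r \<le> V (iterate G \<alpha> x \<sigma> ((j - N) + N))" by simp
      then show "\<sigma> \<in> (\<Union>m. ?B r N m)" by blast
    qed (use le_add2 in blast)
    ultimately show ?thesis by (intro LIMSEQ_le_const2[OF lim[unfolded eq]]) blast
  qed
  show ?thesis
  proof (rule draw.P.AE_tendsto_0_tail_bound[where b = "\<lambda>N. (d N + q N) * exp (q N)"])
    show "(\<lambda>\<sigma>. V (iterate G \<alpha> x \<sigma> l)) \<in> borel_measurable draws" for l
      using measurable_iterate by (rule measurable_compose) simp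
    have "(\<lambda>N. (d N + q N) * exp (q N)) \<longlonglongrightarrow> (0 + 0) * exp 0"
      by (intro tendsto_intros d0 q0)
    then show "(\<lambda>N. (d N + q N) * exp (q N)) \<longlonglongrightarrow> 0" by simp
    show "measure draws {\<sigma> \<in> space draws. \<exists>j\<ge>N. r \<le> V (iterate G \<alpha> x \<sigma> j)}
        \<le> (d N + q N) * exp (q N) / r" if "0 < r" for r N
      unfolding space_draws using U[OF that, of N] by (simp only: UNIV_I simp_thms)
  qed (rule V)
qed

end
end

subsection \<open>Coercive matrices and TD iterates\<close>

text \<open>A zero of a nonnegative form is a minimum, so its gradient vanishes. Concretely, moving
  from \<open>u\<close> by \<open>t\<close> times \<open>w = A u\<close> changes the form by
  \<open>2 * t * n + t\<^sup>2 * R\<close>, where \<open>n\<close> is the squared length of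
  \<open>w\<close>; for a small negative \<open>t\<close> this would be negative unless
  \<open>n = 0\<close>.\<close>

lemma psd_form_kernel:
  fixes A :: "nat \<Rightarrow> nat \<Rightarrow> real"
  assumes sym: "\<And>p q. p < k \<Longrightarrow> q < k \<Longrightarrow> A p q = A q p"
    and psd: "\<And>v. 0 \<le> (\<Sum>p<k. \<Sum>q<k. v p * A p q * v q)"
    and zero: "(\<Sum>p<k. \<Sum>q<k. u p * A p q * u q) = 0"
    and p: "p < k"
  shows "(\<Sum>q<k. A p q * u q) = 0"
proof -
  define w where "w p = (\<Sum>q<k. A p q * u q)" for p
  define n where "n = (\<Sum>p<k. (w p)\<^sup>2)"
  define R where "R = (\<Sum>p<k. \<Sum>q<k. w p * A p q * w q)"
  have n0: "0 \<le> n" unfolding n_def by (simp add: sum_nonneg)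
  have c1: "(\<Sum>p<k. \<Sum>q<k. w p * A p q * u q) = n"
    unfolding n_def power2_eq_square by (subst (2) w_def) (simp add: sum_distrib_left mult.assoc)
  have "(\<Sum>p<k. \<Sum>q<k. u p * A p q * w q) = (\<Sum>p<k. \<Sum>q<k. w p * A p q * u q)"
    by (subst sum.swap) (auto intro!: sum.cong simp: sym)
  then have c2: "(\<Sum>p<k. \<Sum>q<k. u p * A p q * w q) = n" using c1 by simp
  have quad: "0 \<le> 2 * t * n + t\<^sup>2 * R" for t
  proof -
    have "0 \<le> (\<Sum>p<k. \<Sum>q<k. (u p + t * w p) * A p q * (u q + t * w q))" by (rule psd)
    also have "\<dots> = (\<Sum>p<k. \<Sum>q<k. u p * A p q * u q) + t * (\<Sum>p<k. \<Sum>q<k. u p * A p q * w q)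
        + t * (\<Sum>p<k. \<Sum>q<k. w p * A p q * u q) + t\<^sup>2 * R"
      unfolding R_def sum_distrib_left sum.distrib[symmetric]
      by (intro sum.cong) (auto simp: algebra_simps power2_eq_square)
    finally show ?thesis unfolding zero c1 c2 by (simp add: mult.commute mult.left_commute)
  qed
  have "n = 0"
  proof (rule ccontr)
    assume "n \<noteq> 0"
    then have n: "0 < n" using n0 by simp
    \<comment> \<open>A step short enough for the linear term to win: it gives
      \<open>s * \<bar>R\<bar> < n\<close>, and \<open>t = - s\<close> contradicts
      \<open>quad\<close>.\<close>
    define s where "s = n / (\<bar>R\<bar> + 1)"
    have s: "0 < s" "s * (\<bar>R\<bar> + 1) = n" using n by (auto simp: s_def add_nonneg_eq_0_iff)
    have "s * R \<le> s * \<bar>R\<bar>" using s by (intro mult_left_mono) auto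
    also have "\<dots> < 2 * n" using s n by (simp add: algebra_simps)
    finally have "s * (s * R) < s * (2 * n)" using s by simp
    then show False using quad[of "- s"] by (simp add: power2_eq_square algebra_simps)
  qed
  then have "(w p)\<^sup>2 = 0" using p unfolding n_def by (subst (asm) sum_nonneg_eq_0_iff) auto
  then show ?thesis by (simp add: w_def)
qed

text \<open>The dimension \<open>k\<close> is a term, so vectors are sequences vanishing from index
  \<open>k\<close> on. Compactness comes from Tychonoff: the sphere is a closed subset of a product
  of compact intervals and singletons.\<close>

lemma compact_unit_sphere_coords:
  "compact {v :: nat \<Rightarrow> real. (\<forall>i\<ge>k. v i = 0) \<and> (\<Sum>j<k. (v j)\<^sup>2) = 1}" (is "compact ?K")
proof -
  let ?P = "PiE UNIV (\<lambda>i. if i < k then {-1..1} else {0}) :: (nat \<Rightarrow> real) set"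
  have "compactin (product_topology (\<lambda>i. euclidean) UNIV) ?P"
    by (simp add: compactin_PiE)
  then have P: "compact ?P" by (simp add: euclidean_product_topology)
  have "closed {v :: nat \<Rightarrow> real. (\<Sum>j<k. (v j)\<^sup>2) = 1}"
    by (intro closed_Collect_eq continuous_intros continuous_on_product_coordinates)
  then have "compact (?P \<inter> {v. (\<Sum>j<k. (v j)\<^sup>2) = 1})"
    by (rule compact_Int_closed[OF P])
  moreover have "?P \<inter> {v. (\<Sum>j<k. (v j)\<^sup>2) = 1} = ?K"
  proof (intro equalityI subsetI)
    fix v assume "v \<in> ?P \<inter> {v. (\<Sum>j<k. (v j)\<^sup>2) = 1}"
    then have P: "v \<in> ?P" and s: "(\<Sum>j<k. (v j)\<^sup>2) = 1" by auto
    have "v i = 0" if "k \<le> i" for i using PiE_mem[OF P UNIV_I, of i] that by simp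
    then show "v \<in> ?K" using s by simp
  next
    fix v assume v: "v \<in> ?K"
    have "v i \<in> (if i < k then {-1..1} else {0})" for i
    proof (cases "i < k")
      case True
      then have "(v i)\<^sup>2 \<le> (\<Sum>j<k. (v j)\<^sup>2)" by (intro member_le_sum) auto
      then have "\<bar>v i\<bar> \<le> 1" using v by (simp add: abs_square_le_1)
      then show ?thesis using True by auto
    qed (use v in auto)
    then show "v \<in> ?P \<inter> {v. (\<Sum>j<k. (v j)\<^sup>2) = 1}" using v by (simp add: PiE_iff)
  qed
  ultimately show ?thesis by simp
qed

text \<open>The minimum of the quadratic form on the unit sphere is itself an eigenvalue.\<close>

lemma quadratic_form_ge_eigenvalue_bound:
  fixes A :: "nat \<Rightarrow> nat \<Rightarrow> real"
  assumes sym: "\<And>p q. p < k \<Longrightarrow> q < k \<Longrightarrow> A p q = A q p"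
    and ev: "\<And>\<mu>. eigenvalue (mat k k (\<lambda>(p, q). A p q)) \<mu> \<Longrightarrow> c \<le> \<mu>"
  shows "c * (\<Sum>j<k. (v j)\<^sup>2) \<le> (\<Sum>p<k. \<Sum>q<k. v p * A p q * v q)"
\<comment> \<open>For \<open>k = 0\<close> the sphere is empty and has no minimiser; the claim then
  compares two empty sums.\<close>
proof (cases "k = 0")
  case False
  define Q where "Q v = (\<Sum>p<k. \<Sum>q<k. v p * A p q * v q)" for v
  define K where "K = {v :: nat \<Rightarrow> real. (\<forall>i\<ge>k. v i = 0) \<and> (\<Sum>j<k. (v j)\<^sup>2) = 1}"
  have "(\<Sum>j<k. (if j = 0 then 1 else 0 :: real)\<^sup>2) = (\<Sum>j<k. if j = 0 then 1 else 0)"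
    by (intro sum.cong) auto
  then have "(\<lambda>i. if i = 0 then 1 else 0) \<in> K"
    using False by (simp add: K_def)
  then have ne: "K \<noteq> {}" by blast
  have cont: "continuous_on K Q"
    unfolding Q_def
    by (intro continuous_intros continuous_on_subset[OF continuous_on_product_coordinates subset_UNIV])
  have "compact K" unfolding K_def by (rule compact_unit_sphere_coords)
  then obtain u where u: "u \<in> K" and min: "\<And>v. v \<in> K \<Longrightarrow> Q u \<le> Q v"
    using continuous_attains_inf[OF _ ne cont] by blast
  define \<mu> where "\<mu> = Q u"
  have ge: "\<mu> * (\<Sum>j<k. (v j)\<^sup>2) \<le> Q v" for v
  proof (cases "(\<Sum>j<k. (v j)\<^sup>2) = 0")
    case True
    then have "\<And>j. j < k \<Longrightarrow> v j = 0" by (subst (asm) sum_nonneg_eq_0_iff) auto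
    then have "Q v = 0" unfolding Q_def by (intro sum.neutral ballI) auto
    then show ?thesis using True by simp
  next
    case False
    let ?N = "\<Sum>j<k. (v j)\<^sup>2"
    have N: "0 < ?N" using False sum_nonneg[of "{..<k}" "\<lambda>j. (v j)\<^sup>2"] by auto
    \<comment> \<open>The form is homogeneous of degree two, so \<open>v\<close> is rescaled to the
      sphere; entries from \<open>k\<close> on are cleared to stay inside \<open>K\<close>.\<close>
    define w where "w j = (if j < k then v j / sqrt ?N else 0)" for j
    have "(\<Sum>j<k. (w j)\<^sup>2) = (\<Sum>j<k. (v j)\<^sup>2 / ?N)"
      using N by (intro sum.cong) (auto simp: w_def power_divide)
    also have "\<dots> = 1" using N by (simp add: sum_divide_distrib[symmetric])
    finally have "w \<in> K" by (simp add: K_def w_def)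
    then have "\<mu> \<le> Q w" unfolding \<mu>_def by (rule min)
    also have "Q w = (\<Sum>p<k. \<Sum>q<k. v p * A p q * v q / ?N)"
      unfolding Q_def
    proof (intro sum.cong refl)
      fix p q assume "p \<in> {..<k}" "q \<in> {..<k}"
      then have "w p * A p q * w q = v p * A p q * v q / (sqrt ?N * sqrt ?N)"
        by (simp add: w_def)
      also have "sqrt ?N * sqrt ?N = ?N" using N by simp
      finally show "w p * A p q * w q = v p * A p q * v q / ?N" .
    qed
    also have "\<dots> = Q v / ?N" by (simp add: Q_def sum_divide_distrib)
    finally show ?thesis using N by (simp add: field_simps)
  qed
  \<comment> \<open>Subtracting \<open>\<mu>\<close> on the diagonal leaves a positive semidefinite
    form that vanishes at the minimiser \<open>u\<close>. Its kernel then contains \<open>u\<close>,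
    which makes \<open>u\<close> an eigenvector for \<open>\<mu>\<close>.\<close>
  define A' where "A' p q = A p q - (if p = q then \<mu> else 0)" for p q
  have Q': "(\<Sum>p<k. \<Sum>q<k. v p * A' p q * v q) = Q v - \<mu> * (\<Sum>j<k. (v j)\<^sup>2)" for v
  proof -
    have "(\<Sum>q<k. v p * A' p q * v q) = (\<Sum>q<k. v p * A p q * v q) - \<mu> * (v p)\<^sup>2" if "p < k" for p
    proof -
      have "(\<Sum>q<k. v p * A' p q * v q) =
          (\<Sum>q<k. v p * A p q * v q - (if p = q then \<mu> * (v q)\<^sup>2 else 0))"
        by (intro sum.cong) (auto simp: A'_def algebra_simps power2_eq_square)
      then show ?thesis using that by (simp add: sum_subtractf)
    qed
    then show ?thesis unfolding Q_def by (simp add: sum_subtractf sum_distrib_left)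
  qed
  have ker: "(\<Sum>q<k. A' p q * u q) = 0" if "p < k" for p
  proof (rule psd_form_kernel[OF _ _ _ that])
    show "0 \<le> (\<Sum>p<k. \<Sum>q<k. v p * A' p q * v q)" for v unfolding Q' using ge[of v] by simp
    show "(\<Sum>p<k. \<Sum>q<k. u p * A' p q * u q) = 0" unfolding Q' using u by (simp add: K_def \<mu>_def)
  qed (auto simp: A'_def sym)
  have Au: "(\<Sum>q<k. A p q * u q) = \<mu> * u p" if "p < k" for p
  proof -
    have "(\<Sum>q<k. A' p q * u q) = (\<Sum>q<k. A p q * u q - (if p = q then \<mu> * u q else 0))"
      by (intro sum.cong) (auto simp: A'_def algebra_simps)
    then show ?thesis using ker[OF that] that by (simp add: sum_subtractf)
  qed
  have "eigenvector (mat k k (\<lambda>(p, q). A p q)) (vec k u) \<mu>"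
    unfolding eigenvector_def
  proof (intro conjI)
    show "vec k u \<noteq> 0\<^sub>v (dim_row (mat k k (\<lambda>(p, q). A p q)))"
    proof
      assume "vec k u = 0\<^sub>v (dim_row (mat k k (\<lambda>(p, q). A p q)))"
      then have "\<And>j. j < k \<Longrightarrow> u j = 0" by (auto simp: vec_eq_iff)
      then show False using u by (simp add: K_def)
    qed
    show "mat k k (\<lambda>(p, q). A p q) *\<^sub>v vec k u = \<mu> \<cdot>\<^sub>v vec k u"
      by (rule eq_vecI) (auto simp: scalar_prod_def atLeast0LessThan Au)
  qed auto
  then have "c \<le> \<mu>" using ev unfolding eigenvalue_def by blast
  then have "c * (\<Sum>j<k. (v j)\<^sup>2) \<le> \<mu> * (\<Sum>j<k. (v j)\<^sup>2)" by (intro mult_right_mono sum_nonneg) auto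
  then show ?thesis using ge[of v] unfolding Q_def by linarith
qed auto

section \<open>Inverses of coercive matrices\<close>

lemma minv_right_inverse:
  fixes A :: "real mat"
  assumes A: "A \<in> carrier_mat k k" and det: "det A \<noteq> 0"
  shows "invertible_mat A" "minv A \<in> carrier_mat k k" "A * minv A = 1\<^sub>m k"
proof -
  from det_non_zero_imp_unit[OF A det, unfolded Units_def, of "()"]
  obtain B where B: "B \<in> carrier_mat k k" "B * A = 1\<^sub>m k" "A * B = 1\<^sub>m k"
    by (auto simp: ring_mat_def)
  have "minv A = B"
    unfolding minv_def
  proof (rule the_equality)
    show "B \<in> carrier_mat (dim_row A) (dim_row A) \<and> A * B = 1\<^sub>m (dim_row A) \<and> B * A = 1\<^sub>m (dim_row A)"
      using A B by auto
    fix B' assume "B' \<in> carrier_mat (dim_row A) (dim_row A) \<and> A * B' = 1\<^sub>m (dim_row A) \<and> B' * A = 1\<^sub>m (dim_row A)"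
    then have B': "B' \<in> carrier_mat k k" "B' * A = 1\<^sub>m k" using A by auto
    have "B' = B' * (A * B)" using B B' by simp
    also have "\<dots> = (B' * A) * B" by (rule assoc_mult_mat[symmetric, OF B'(1) A B(1)])
    also have "\<dots> = B" using B B' by simp
    finally show "B' = B" .
  qed
  then show "minv A \<in> carrier_mat k k" "A * minv A = 1\<^sub>m k" using B by auto
  show "invertible_mat A"
    unfolding invertible_mat_def inverts_mat_def using A B by (auto intro!: exI[of _ B])
qed

text \<open>A kernel vector makes the quadratic form vanish, which coercivity forbids. The argument
  suits TD matrices, which are in general not symmetric.\<close>

lemma det_nonzero_if_coercive:
  fixes A :: "real mat"
  assumes A: "A \<in> carrier_mat k k" and e: "0 < \<epsilon>"
    and pd: "\<And>c :: nat \<Rightarrow> real. \<epsilon> * (\<Sum>j<k. (c j)\<^sup>2) \<le> (\<Sum>p<k. \<Sum>q<k. c p * A $$ (p, q) * c q)"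
  shows "det A \<noteq> 0"
proof
  assume "det A = 0"
  then obtain v where v: "v \<in> carrier_vec k" "v \<noteq> 0\<^sub>v k" "A *\<^sub>v v = 0\<^sub>v k"
    using det_0_iff_vec_prod_zero[OF A] by blast
  have "(\<Sum>q<k. A $$ (p, q) * v $ q) = 0" if "p < k" for p
  proof -
    have "(A *\<^sub>v v) $ p = (\<Sum>q<k. A $$ (p, q) * v $ q)"
      using A v(1) that by (simp add: scalar_prod_def atLeast0LessThan)
    then show ?thesis using v that by simp
  qed
  then have "(\<Sum>p<k. \<Sum>q<k. v $ p * A $$ (p, q) * v $ q) = 0"
    by (simp add: mult.assoc sum_distrib_left[symmetric])
  then have "\<epsilon> * (\<Sum>j<k. (v $ j)\<^sup>2) \<le> 0" using pd[of "\<lambda>j. v $ j"] by simp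
  then have "(\<Sum>j<k. (v $ j)\<^sup>2) \<le> 0" using e by (simp add: mult_le_0_iff)
  then have "(\<Sum>j<k. (v $ j)\<^sup>2) = 0" by (intro antisym sum_nonneg) auto
  then have "\<And>j. j < k \<Longrightarrow> v $ j = 0" by (subst (asm) sum_nonneg_eq_0_iff) auto
  then show False using v by (auto simp: vec_eq_iff)
qed

text \<open>Here \<open>x\<close> stands for the error, \<open>g s\<close> for the update direction,
  and \<open>\<rho> s\<close> for the residual at the limit. Expanding the square, the first-order
  term has a residual part that \<open>centred\<close> annihilates and a linear part that
  \<open>pd\<close> makes contracting. The second-order term is at most quadratic in
  \<open>x\<close> plus a constant, since \<open>\<rho> s + h s x\<close> grows linearly.\<close>

lemma linear_drift:
  fixes g h :: "'i \<Rightarrow> nat \<Rightarrow> real" and \<rho> :: "'i \<Rightarrow> real"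
  assumes I: "finite I" "I \<noteq> {}"
    and centred: "\<And>p. p < k \<Longrightarrow> (\<Sum>s\<in>I. g s p * \<rho> s) = 0"
    and pd: "\<And>x :: nat \<Rightarrow> real. \<epsilon> * (\<Sum>j<k. (x j)\<^sup>2) * card I \<le> - (\<Sum>s\<in>I. (\<Sum>p<k. x p * g s p) * (\<Sum>q<k. h s q * x q))"
  obtains C where "\<epsilon>\<^sup>2 \<le> C"
    "\<And>(a :: real) (x :: nat \<Rightarrow> real). 0 \<le> a \<Longrightarrow> (\<Sum>s\<in>I. \<Sum>j<k. (x j + a * (\<rho> s + (\<Sum>q<k. h s q * x q)) * g s j)\<^sup>2) / card I
      \<le> (1 - 2 * \<epsilon> * a + C * a\<^sup>2) * (\<Sum>j<k. (x j)\<^sup>2) + C * a\<^sup>2"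
proof
  define N where "N s = (\<Sum>j<k. (g s j)\<^sup>2)" for s
  define H where "H s = (\<Sum>j<k. (h s j)\<^sup>2)" for s
  define C1 where "C1 = (\<Sum>s\<in>I. 2 * (\<rho> s)\<^sup>2 * N s)"
  define C2 where "C2 = (\<Sum>s\<in>I. 2 * H s * N s)"
  \<comment> \<open>\<open>C1\<close> and \<open>C2\<close> bound the second-order term;
    \<open>\<epsilon>\<^sup>2\<close> is added so that the contraction factor is never
    negative.\<close>
  define C where "C = \<epsilon>\<^sup>2 + C1 + C2"
  have N: "0 \<le> N s" and H: "0 \<le> H s" for s unfolding N_def H_def by (simp_all add: sum_nonneg)
  have C1: "0 \<le> C1" and C2: "0 \<le> C2" unfolding C1_def C2_def using N H by (simp_all add: sum_nonneg)
  show "\<epsilon>\<^sup>2 \<le> C" using C1 C2 by (simp add: C_def)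
  fix a :: real and x :: "nat \<Rightarrow> real" assume a: "0 \<le> a"
  define X where "X = (\<Sum>j<k. (x j)\<^sup>2)"
  define \<delta> where "\<delta> s = \<rho> s + (\<Sum>q<k. h s q * x q)" for s
  define n where "n = real (card I)"
  have n: "1 \<le> n" unfolding n_def using I by (simp add: Suc_leI card_gt_0_iff)
  have X: "0 \<le> X" unfolding X_def by (simp add: sum_nonneg)
  have expand: "(\<Sum>j<k. (x j + a * \<delta> s * g s j)\<^sup>2) =
      X + 2 * a * (\<delta> s * (\<Sum>p<k. x p * g s p)) + a\<^sup>2 * ((\<delta> s)\<^sup>2 * N s)" for s
    unfolding X_def N_def sum_distrib_left sum.distrib[symmetric]
    by (intro sum.cong) (auto simp: power2_eq_square algebra_simps)
  have cross: "(\<Sum>s\<in>I. \<delta> s * (\<Sum>p<k. x p * g s p)) \<le> - (\<epsilon> * X * n)"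
  proof -
    have "(\<Sum>s\<in>I. \<rho> s * (\<Sum>p<k. x p * g s p)) = (\<Sum>p<k. x p * (\<Sum>s\<in>I. g s p * \<rho> s))"
      unfolding sum_distrib_left by (subst sum.swap) (auto intro!: sum.cong simp: algebra_simps)
    also have "\<dots> = 0" using centred by simp
    finally have 0: "(\<Sum>s\<in>I. \<rho> s * (\<Sum>p<k. x p * g s p)) = 0" .
    have "(\<Sum>s\<in>I. \<delta> s * (\<Sum>p<k. x p * g s p)) =
        (\<Sum>s\<in>I. \<rho> s * (\<Sum>p<k. x p * g s p)) + (\<Sum>s\<in>I. (\<Sum>p<k. x p * g s p) * (\<Sum>q<k. h s q * x q))"
      unfolding \<delta>_def sum.distrib[symmetric] by (intro sum.cong) (auto simp: distrib_right)
    then show ?thesis using pd[of x] 0 by (simp add: X_def n_def)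
  qed
  have sq: "(\<Sum>s\<in>I. (\<delta> s)\<^sup>2 * N s) \<le> C1 + C2 * X"
  proof -
    have "(\<delta> s)\<^sup>2 * N s \<le> 2 * (\<rho> s)\<^sup>2 * N s + 2 * H s * N s * X" for s
    proof -
      have "(\<delta> s)\<^sup>2 \<le> 2 * (\<rho> s)\<^sup>2 + 2 * (\<Sum>q<k. h s q * x q)\<^sup>2"
        unfolding \<delta>_def using sum_squares_ge_zero[of "\<rho> s - (\<Sum>q<k. h s q * x q)" 0]
        by (simp add: power2_eq_square algebra_simps)
      also have "(\<Sum>q<k. h s q * x q)\<^sup>2 \<le> H s * X"
        unfolding H_def X_def by (rule Cauchy_Schwarz_ineq_sum)
      finally have "(\<delta> s)\<^sup>2 \<le> 2 * (\<rho> s)\<^sup>2 + 2 * (H s * X)" by simp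
      then have "(\<delta> s)\<^sup>2 * N s \<le> (2 * (\<rho> s)\<^sup>2 + 2 * (H s * X)) * N s" by (intro mult_right_mono N)
      then show ?thesis by (simp add: algebra_simps)
    qed
    then have "(\<Sum>s\<in>I. (\<delta> s)\<^sup>2 * N s) \<le> (\<Sum>s\<in>I. 2 * (\<rho> s)\<^sup>2 * N s + 2 * H s * N s * X)" by (intro sum_mono)
    also have "\<dots> = C1 + C2 * X" by (simp add: C1_def C2_def sum.distrib sum_distrib_right)
    finally show ?thesis .
  qed
  have "(\<Sum>s\<in>I. \<Sum>j<k. (x j + a * \<delta> s * g s j)\<^sup>2) =
      n * X + 2 * a * (\<Sum>s\<in>I. \<delta> s * (\<Sum>p<k. x p * g s p)) + a\<^sup>2 * (\<Sum>s\<in>I. (\<delta> s)\<^sup>2 * N s)"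
    unfolding expand by (simp add: sum.distrib sum_distrib_left n_def)
  also have "\<dots> \<le> n * X + 2 * a * (- (\<epsilon> * X * n)) + a\<^sup>2 * (C1 + C2 * X)"
    by (intro add_mono mult_left_mono[OF cross] mult_left_mono[OF sq] order_refl) (use a in auto)
  \<comment> \<open>\<open>C1\<close> and \<open>C2\<close> are sums over \<open>I\<close>, not
    averages; \<open>1 \<le> n\<close> absorbs the difference.\<close>
  also have "\<dots> \<le> n * X + 2 * a * (- (\<epsilon> * X * n)) + n * (a\<^sup>2 * (C + C * X))"
  proof -
    have "C1 \<le> C" "C2 \<le> C" using C1 C2 by (auto simp: C_def)
    then have "C1 + C2 * X \<le> C + C * X" using X by (intro add_mono mult_right_mono)
    moreover have "0 \<le> C1 + C2 * X" using C1 C2 X by simp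
    ultimately have "1 * (a\<^sup>2 * (C1 + C2 * X)) \<le> n * (a\<^sup>2 * (C + C * X))"
      using n by (intro mult_mono mult_left_mono) auto
    then show ?thesis by simp
  qed
  also have "\<dots> = n * ((1 - 2 * \<epsilon> * a + C * a\<^sup>2) * X + C * a\<^sup>2)"
    by (simp add: algebra_simps)
  finally have "(\<Sum>s\<in>I. \<Sum>j<k. (x j + a * \<delta> s * g s j)\<^sup>2) / n
      \<le> (1 - 2 * \<epsilon> * a + C * a\<^sup>2) * X + C * a\<^sup>2"
    using n by (simp add: divide_le_eq mult.commute)
  then show "(\<Sum>s\<in>I. \<Sum>j<k. (x j + a * (\<rho> s + (\<Sum>q<k. h s q * x q)) * g s j)\<^sup>2) / card I
      \<le> (1 - 2 * \<epsilon> * a + C * a\<^sup>2) * (\<Sum>j<k. (x j)\<^sup>2) + C * a\<^sup>2"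
    unfolding \<delta>_def X_def n_def .
qed

text \<open>The empirical average is exactly the mean over a uniform draw, so the mean update
  direction of TD learning is \<open>b - A w\<close> with the sample quantities.
  \<open>2 \<le> T\<close> reconciles the natural-number \<open>T - 1\<close> with the real
  one.\<close>

lemma En_eq_average:
  assumes "2 \<le> T"
  shows "En T n D f = (\<Sum>s\<in>idxset T n. f (D (fst s) (snd s)) (D (fst s) (Suc (snd s)))) / card (idxset T n)"
proof -
  have idx: "idxset T n = {..<n} \<times> {1..T-1}" by (auto simp: idxset_def)
  have "real (card (idxset T n)) = real n * (real T - 1)"
    using assms unfolding idx card_cartesian_product by (simp add: of_nat_diff)
  moreover have "(\<Sum>s\<in>idxset T n. f (D (fst s) (snd s)) (D (fst s) (Suc (snd s)))) =
      (\<Sum>i<n. \<Sum>t\<in>{1..T-1}. f (D i t) (D i (Suc t)))"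
    unfolding idx by (subst sum.cartesian_product) (simp add: split_beta)
  ultimately show ?thesis by (simp add: En_def)
qed

lemma tdmat_carrier: "tdmat T n D \<beta> k f \<in> carrier_mat k k"
  by (simp add: tdmat_def)

text \<open>The reward \<open>R\<close> is a free array over individuals and periods, so that the
  same statement serves both recursions: one reads its reward at \<open>t\<close>, the other at
  \<open>Suc t\<close>. In the coordinates \<open>w - wh\<close>, where \<open>wh\<close> solves
  \<open>A w = b\<close>, the update has the form treated in \<open>linear_drift\<close>.\<close>

lemma td_AE_tendsto:
  fixes D :: "nat \<Rightarrow> nat \<Rightarrow> 's" and f :: "nat \<Rightarrow> 's \<Rightarrow> real" and R :: "nat \<Rightarrow> nat \<Rightarrow> real"
    and T n k :: nat and \<beta> :: real
  defines "A \<equiv> tdmat T n D \<beta> k f"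
    and "b \<equiv> vec k (\<lambda>p. (\<Sum>s\<in>idxset T n. f p (D (fst s) (snd s)) * R (fst s) (snd s)) / card (idxset T n))"
  assumes n: "0 < n" and T: "2 \<le> T" and e: "0 < \<epsilon>"
    and pd: "\<And>c :: nat \<Rightarrow> real. \<epsilon> * (\<Sum>j<k. (c j)\<^sup>2) \<le> (\<Sum>p<k. \<Sum>q<k. c p * A $$ (p, q) * c q)"
    and \<alpha>: "\<And>l. 0 \<le> \<alpha> l"
    and div: "filterlim (\<lambda>m. \<Sum>l<m. \<alpha> l) at_top sequentially"
    and sq: "summable (\<lambda>l. (\<alpha> l)\<^sup>2)"
    and w0: "w0 \<in> carrier_vec k"
  shows "AE \<sigma> in drawM T n. \<forall>j<k.
    (\<lambda>l. td \<alpha> \<beta> (\<lambda>i t. fvec k f (D i t)) R w0 \<sigma> l $ j) \<longlonglongrightarrow> (minv A *\<^sub>v b) $ j"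
proof -
  let ?I = "idxset T n"
  define N where "N = real (card ?I)"
  have idx: "?I = {..<n} \<times> {1..T-1}" by (auto simp: idxset_def)
  have I: "finite ?I" "?I \<noteq> {}" unfolding idx using n T by auto
  have N: "0 < N" using I by (simp add: N_def card_gt_0_iff)
  interpret finite_draws ?I by unfold_locales (fact I)+
  have A: "A \<in> carrier_mat k k" unfolding A_def by (rule tdmat_carrier)
  have b: "b \<in> carrier_vec k" by (simp add: b_def)
  note inv = minv_right_inverse[OF A det_nonzero_if_coercive[OF A e pd]]
  define wh where "wh = minv A *\<^sub>v b"
  have wh: "wh \<in> carrier_vec k" using inv(2) b by (simp add: wh_def)
  have "A *\<^sub>v wh = (A * minv A) *\<^sub>v b"
    unfolding wh_def using assoc_mult_mat_vec[OF A inv(2) b] by simp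
  then have Awh: "A *\<^sub>v wh = b" using inv(3) b by simp
  define g where "g s j = f j (D (fst s) (snd s))" for s j
  define h where "h s j = \<beta> * f j (D (fst s) (Suc (snd s))) - f j (D (fst s) (snd s))" for s j
  \<comment> \<open>The TD error at \<open>wh\<close>. Its average against the basis function
    \<open>p\<close> is entry \<open>p\<close> of \<open>b - A wh\<close>, hence zero.\<close>
  define \<rho> where "\<rho> s = R (fst s) (snd s) + (\<Sum>q<k. h s q * wh $ q)" for s
  have Apq: "A $$ (p, q) = - (\<Sum>s\<in>?I. g s p * h s q) / N" if "p < k" "q < k" for p q
    unfolding A_def tdmat_def using that
    by (simp add: En_eq_average[OF T] g_def h_def N_def sum_negf[symmetric] algebra_simps)
  have quad: "(\<Sum>p<k. \<Sum>q<k. x p * A $$ (p, q) * y q) =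
      - (\<Sum>s\<in>?I. (\<Sum>p<k. x p * g s p) * (\<Sum>q<k. h s q * y q)) / N" for x y :: "nat \<Rightarrow> real"
  proof -
    have "(\<Sum>p<k. \<Sum>q<k. x p * A $$ (p, q) * y q) =
        (\<Sum>p<k. \<Sum>q<k. \<Sum>s\<in>?I. - (x p * g s p * (h s q * y q)) / N)"
      by (intro sum.cong refl) (simp add: Apq sum_distrib_left sum_distrib_right sum_divide_distrib sum_negf[symmetric] mult.assoc)
    also have "\<dots> = (\<Sum>p<k. \<Sum>s\<in>?I. \<Sum>q<k. - (x p * g s p * (h s q * y q)) / N)"
      by (intro sum.cong refl sum.swap)
    also have "\<dots> = (\<Sum>s\<in>?I. \<Sum>p<k. \<Sum>q<k. - (x p * g s p * (h s q * y q)) / N)"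
      by (rule sum.swap)
    also have "\<dots> = - (\<Sum>s\<in>?I. (\<Sum>p<k. x p * g s p) * (\<Sum>q<k. h s q * y q)) / N"
      by (simp add: sum_product sum_negf sum_divide_distrib)
    finally show ?thesis .
  qed
  have centred: "(\<Sum>s\<in>?I. g s p * \<rho> s) = 0" if p: "p < k" for p
  proof -
    have "b $ p = (\<Sum>q<k. A $$ (p, q) * wh $ q)"
      unfolding Awh[symmetric] using A wh p by (simp add: scalar_prod_def atLeast0LessThan)
    also have "\<dots> = (\<Sum>q<k. - (\<Sum>s\<in>?I. g s p * (h s q * wh $ q)) / N)"
      using p by (intro sum.cong) (simp_all add: Apq sum_distrib_right mult.assoc)
    also have "\<dots> = - (\<Sum>q<k. \<Sum>s\<in>?I. g s p * (h s q * wh $ q)) / N"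
      by (simp add: sum_negf sum_divide_distrib)
    also have "\<dots> = - (\<Sum>s\<in>?I. g s p * (\<Sum>q<k. h s q * wh $ q)) / N"
      by (subst sum.swap) (simp add: sum_distrib_left)
    finally have "(\<Sum>s\<in>?I. g s p * R (fst s) (snd s)) / N = - (\<Sum>s\<in>?I. g s p * (\<Sum>q<k. h s q * wh $ q)) / N"
      using p by (simp add: b_def g_def N_def)
    then have "(\<Sum>s\<in>?I. g s p * R (fst s) (snd s)) + (\<Sum>s\<in>?I. g s p * (\<Sum>q<k. h s q * wh $ q)) = 0"
      using N by (simp only: eq_neg_iff_add_eq_0 minus_divide_left[symmetric]
          add_divide_distrib[symmetric] divide_eq_0_iff) simp
    then show ?thesis by (simp add: \<rho>_def distrib_left sum.distrib)
  qed
  have pd': "\<epsilon> * (\<Sum>j<k. (x j)\<^sup>2) * card ?I \<le> - (\<Sum>s\<in>?I. (\<Sum>p<k. x p * g s p) * (\<Sum>q<k. h s q * x q))" for x :: "nat \<Rightarrow> real"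
    using pd[of x] unfolding quad pos_le_divide_eq[OF N] unfolding N_def .
  obtain C where C: "\<epsilon>\<^sup>2 \<le> C" and drift:
    "\<And>(a :: real) (x :: nat \<Rightarrow> real). 0 \<le> a \<Longrightarrow> (\<Sum>s\<in>?I. \<Sum>j<k. (x j + a * (\<rho> s + (\<Sum>q<k. h s q * x q)) * g s j)\<^sup>2) / card ?I
      \<le> (1 - 2 * \<epsilon> * a + C * a\<^sup>2) * (\<Sum>j<k. (x j)\<^sup>2) + C * a\<^sup>2"
  proof (rule linear_drift[of ?I k g \<rho> \<epsilon> h, OF I])
    show "(\<Sum>s\<in>?I. g s p * \<rho> s) = 0" if "p < k" for p using that by (rule centred)
  qed (use pd' in blast)+
  define V where "V w = (\<Sum>j<k. (w $ j - wh $ j)\<^sup>2)" for w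
  define G where "G a s w = (let i = fst s; t = snd s in
    w + (a * (R i t + \<beta> * (fvec k f (D i (Suc t)) \<bullet> w) - fvec k f (D i t) \<bullet> w)) \<cdot>\<^sub>v fvec k f (D i t))"
    for a :: real and s :: "nat \<times> nat" and w :: "real vec"
  have td: "td \<alpha> \<beta> (\<lambda>i t. fvec k f (D i t)) R w0 \<sigma> l = iterate G \<alpha> w0 \<sigma> l" for \<sigma> l
    by (induction l) (simp_all add: G_def Let_def)
  have G: "G a s w \<in> carrier_vec k" if "w \<in> carrier_vec k" for a s w
    using that by (simp add: G_def Let_def fvec_def)
  have Gj: "G a s w $ j - wh $ j = (w $ j - wh $ j) + a * (\<rho> s + (\<Sum>q<k. h s q * (w $ q - wh $ q))) * g s j"
    if w: "w \<in> carrier_vec k" and j: "j < k" for a s w j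
  proof -
    have "R (fst s) (snd s) + \<beta> * (fvec k f (D (fst s) (Suc (snd s))) \<bullet> w) - fvec k f (D (fst s) (snd s)) \<bullet> w
        = R (fst s) (snd s) + (\<Sum>q<k. h s q * w $ q)"
      using w by (simp add: scalar_prod_def fvec_def h_def atLeast0LessThan sum_distrib_left
          sum_subtractf algebra_simps)
    also have "\<dots> = \<rho> s + (\<Sum>q<k. h s q * (w $ q - wh $ q))"
      by (simp add: \<rho>_def right_diff_distrib sum_subtractf)
    finally show ?thesis using w j by (simp add: G_def Let_def fvec_def g_def)
  qed
  have "AE \<sigma> in draws. (\<lambda>l. V (iterate G \<alpha> w0 \<sigma> l)) \<longlonglongrightarrow> 0"
  proof (rule iterate_AE_tendsto[where S = "carrier_vec k" and \<epsilon> = \<epsilon> and C = C])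
    show "G a s w \<in> carrier_vec k" if "w \<in> carrier_vec k" for a s w by (rule G[OF that])
    show "0 \<le> V w" for w by (simp add: V_def sum_nonneg)
    show "(\<Sum>s\<in>?I. V (G a s w)) / card ?I \<le> (1 - 2 * \<epsilon> * a + C * a\<^sup>2) * V w + C * a\<^sup>2"
      if "0 \<le> a" "w \<in> carrier_vec k" for a w
    proof -
      have "(\<Sum>s\<in>?I. V (G a s w)) = (\<Sum>s\<in>?I. \<Sum>j<k. ((w $ j - wh $ j) +
          a * (\<rho> s + (\<Sum>q<k. h s q * (w $ q - wh $ q))) * g s j)\<^sup>2)"
        unfolding V_def by (intro sum.cong refl) (simp add: Gj that)
      then show ?thesis using drift[OF that(1), of "\<lambda>j. w $ j - wh $ j"] by (simp only: V_def)
    qed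
  qed (fact e C w0 \<alpha> div sq)+
  then show ?thesis
    unfolding drawM_def td wh_def[symmetric]
  proof eventually_elim
    case (elim \<sigma>)
    show ?case
    proof (intro allI impI)
      fix j assume j: "j < k"
      let ?w = "\<lambda>l. iterate G \<alpha> w0 \<sigma> l $ j"
      have "(\<lambda>l. sqrt (V (iterate G \<alpha> w0 \<sigma> l))) \<longlonglongrightarrow> sqrt 0"
        using elim by (rule tendsto_real_sqrt)
      then have lim: "(\<lambda>l. sqrt (V (iterate G \<alpha> w0 \<sigma> l))) \<longlonglongrightarrow> 0" by simp
      \<comment> \<open>Each coordinate error is at most the Euclidean distance, so all coordinates
        converge on the same null set of draw sequences.\<close>
      have "norm (?w l - wh $ j) \<le> sqrt (V (iterate G \<alpha> w0 \<sigma> l))" for l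
      proof -
        have "(?w l - wh $ j)\<^sup>2 \<le> V (iterate G \<alpha> w0 \<sigma> l)"
          unfolding V_def using j by (intro member_le_sum[where f = "\<lambda>j. (iterate G \<alpha> w0 \<sigma> l $ j - wh $ j)\<^sup>2"]) auto
        then show ?thesis using real_le_rsqrt[of "norm (?w l - wh $ j)"] by simp
      qed
      then have "(\<lambda>l. ?w l - wh $ j) \<longlonglongrightarrow> 0"
        by (intro Lim_null_comparison[OF always_eventually lim]) auto
      then show "?w \<longlonglongrightarrow> wh $ j" by (simp add: LIM_zero_iff)
    qed
  qed
qed

subsection \<open>Coercivity of the sample matrix\<close>

text \<open>Products of distinct centred variables integrate to zero, so \<open>n\<close> diagonal
  terms remain out of \<open>n\<^sup>2\<close>. The bound is only almost sure because basis
  functions are bounded on the compact domain, where the data lie almost surely. Each variable is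
  centred at its own mean.\<close>

lemma (in prob_space) variance_sum_indep_bounded:
  fixes Z :: "nat \<Rightarrow> 'a \<Rightarrow> real"
  assumes Z: "indep_vars (\<lambda>_. borel) Z UNIV" and b: "\<And>i. AE \<omega> in M. \<bar>Z i \<omega>\<bar> \<le> b"
  shows "expectation (\<lambda>\<omega>. (\<Sum>i<n. Z i \<omega> - expectation (Z i))\<^sup>2) \<le> n * b\<^sup>2"
    and "integrable M (\<lambda>\<omega>. (\<Sum>i<n. Z i \<omega> - expectation (Z i))\<^sup>2)"
proof -
  have Zm [measurable]: "Z i \<in> borel_measurable M" for i
    using Z unfolding indep_vars_def by simp
  have Zi: "integrable M (Z i)" for i
    by (rule integrable_const_bound[of _ b]) (use b in simp_all)
  define X where "X i \<omega> = Z i \<omega> - expectation (Z i)" for i \<omega>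
  have Xm [measurable]: "X i \<in> borel_measurable M" for i unfolding X_def by measurable
  have Xi: "integrable M (X i)" for i unfolding X_def using Zi by simp
  have X0: "expectation (X i) = 0" for i unfolding X_def using Zi by (simp add: prob_space)
  have indX: "indep_vars (\<lambda>_. borel) X UNIV"
    unfolding X_def by (rule indep_vars_compose2[OF Z, where Y = "\<lambda>i x. x - expectation (Z i)"]) simp
  have pair: "expectation (\<lambda>\<omega>. X i \<omega> * X j \<omega>) = 0 \<and> integrable M (\<lambda>\<omega>. X i \<omega> * X j \<omega>)" if "i \<noteq> j" for i j
  proof -
    have ind: "indep_vars (\<lambda>_. borel) X {i, j}" by (rule indep_vars_subset[OF indX]) simp
    show ?thesis
      using indep_vars_lebesgue_integral[OF _ ind Xi] indep_vars_integrable[OF _ ind Xi] that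
      by (simp add: X0)
  qed
  have sq: "expectation (\<lambda>\<omega>. X i \<omega> * X i \<omega>) \<le> b\<^sup>2 \<and> integrable M (\<lambda>\<omega>. X i \<omega> * X i \<omega>)" for i
  proof -
    have ZZ: "AE \<omega> in M. (Z i \<omega>)\<^sup>2 \<le> b\<^sup>2"
      using b[of i] by eventually_elim (metis abs_le_square_iff abs_of_nonneg abs_ge_zero order_trans power2_abs power_mono)
    have Z2i: "integrable M (\<lambda>\<omega>. (Z i \<omega>)\<^sup>2)"
      by (rule integrable_const_bound[of _ "b\<^sup>2"]) (use ZZ in simp_all)
    have eq: "X i \<omega> * X i \<omega> = (Z i \<omega>)\<^sup>2 - 2 * expectation (Z i) * Z i \<omega> + (expectation (Z i))\<^sup>2" for \<omega>
      by (simp add: X_def power2_eq_square algebra_simps)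
    have "expectation (\<lambda>\<omega>. X i \<omega> * X i \<omega>) = expectation (\<lambda>\<omega>. (Z i \<omega>)\<^sup>2) - (expectation (Z i))\<^sup>2"
      unfolding eq using Z2i Zi by (simp add: prob_space power2_eq_square)
    also have "\<dots> \<le> expectation (\<lambda>\<omega>. (Z i \<omega>)\<^sup>2)" by simp
    also have "\<dots> \<le> expectation (\<lambda>\<omega>. b\<^sup>2)" by (rule integral_mono_AE) (use Z2i ZZ in simp_all)
    finally show ?thesis unfolding eq using Z2i Zi by (simp add: prob_space)
  qed
  have int: "integrable M (\<lambda>\<omega>. X i \<omega> * X j \<omega>)" for i j
    by (cases "i = j") (use pair sq in auto)
  have expand: "(\<Sum>i<n. X i \<omega>)\<^sup>2 = (\<Sum>i<n. \<Sum>j<n. X i \<omega> * X j \<omega>)" for \<omega>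
    by (simp add: power2_eq_square sum_product)
  have "expectation (\<lambda>\<omega>. (\<Sum>i<n. X i \<omega>)\<^sup>2) = (\<Sum>i<n. \<Sum>j<n. expectation (\<lambda>\<omega>. X i \<omega> * X j \<omega>))"
    unfolding expand using int by simp
  also have "\<dots> = (\<Sum>i<n. \<Sum>j<n. if i = j then expectation (\<lambda>\<omega>. X i \<omega> * X i \<omega>) else 0)"
    by (intro sum.cong refl) (use pair in auto)
  also have "\<dots> = (\<Sum>i<n. expectation (\<lambda>\<omega>. X i \<omega> * X i \<omega>))" by simp
  also have "\<dots> \<le> (\<Sum>i<n. b\<^sup>2)" by (intro sum_mono) (use sq in blast)
  finally show "expectation (\<lambda>\<omega>. (\<Sum>i<n. Z i \<omega> - expectation (Z i))\<^sup>2) \<le> n * b\<^sup>2"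
    unfolding X_def by simp
  show "integrable M (\<lambda>\<omega>. (\<Sum>i<n. Z i \<omega> - expectation (Z i))\<^sup>2)"
    unfolding X_def[symmetric] expand using int by simp
qed

lemma integral_double_sum:
  fixes F :: "nat \<Rightarrow> nat \<Rightarrow> 'w \<Rightarrow> real"
  assumes "\<And>p q. p < k \<Longrightarrow> q < k \<Longrightarrow> integrable M (F p q)"
  shows "(\<integral>\<omega>. (\<Sum>p<k. \<Sum>q<k. F p q \<omega>) \<partial>M) = (\<Sum>p<k. \<Sum>q<k. \<integral>\<omega>. F p q \<omega> \<partial>M)"
proof -
  have "(\<integral>\<omega>. (\<Sum>p<k. \<Sum>q<k. F p q \<omega>) \<partial>M) = (\<Sum>p<k. \<integral>\<omega>. (\<Sum>q<k. F p q \<omega>) \<partial>M)"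
    using assms by (intro Bochner_Integration.integral_sum Bochner_Integration.integrable_sum) auto
  also have "\<dots> = (\<Sum>p<k. \<Sum>q<k. \<integral>\<omega>. F p q \<omega> \<partial>M)"
    using assms by (intro sum.cong refl Bochner_Integration.integral_sum) auto
  finally show ?thesis .
qed

text \<open>Cauchy-Schwarz over index pairs: the Frobenius norm dominates the quadratic form for all
  \<open>c\<close> at once. It is thus enough to estimate second moments entry by entry.\<close>

lemma bilinear_perturbation:
  fixes d :: "nat \<Rightarrow> nat \<Rightarrow> real"
  assumes "(\<Sum>p<k. \<Sum>q<k. (d p q)\<^sup>2) \<le> \<epsilon>\<^sup>2" "0 \<le> \<epsilon>"
  shows "\<bar>\<Sum>p<k. \<Sum>q<k. c p * d p q * c q\<bar> \<le> \<epsilon> * (\<Sum>j<k. (c j)\<^sup>2)"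
proof -
  let ?J = "{..<k} \<times> {..<k}"
  have cc: "(\<Sum>(p,q)\<in>?J. (c p * c q)\<^sup>2) = (\<Sum>j<k. (c j)\<^sup>2)\<^sup>2"
    unfolding sum.cartesian_product[symmetric] power2_eq_square[of "sum _ _"] sum_product
    by (simp add: power_mult_distrib)
  have "(\<Sum>p<k. \<Sum>q<k. c p * d p q * c q)\<^sup>2 = (\<Sum>s\<in>?J. (c (fst s) * c (snd s)) * d (fst s) (snd s))\<^sup>2"
    by (simp add: sum.cartesian_product split_beta mult.commute mult.left_commute)
  also have "\<dots> \<le> (\<Sum>s\<in>?J. (c (fst s) * c (snd s))\<^sup>2) * (\<Sum>s\<in>?J. (d (fst s) (snd s))\<^sup>2)"
    by (rule Cauchy_Schwarz_ineq_sum)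
  also have "\<dots> \<le> (\<Sum>s\<in>?J. (c (fst s) * c (snd s))\<^sup>2) * \<epsilon>\<^sup>2"
    using assms(1) by (intro mult_left_mono sum_nonneg) (auto simp: sum.cartesian_product split_beta)
  also have "(\<Sum>s\<in>?J. (c (fst s) * c (snd s))\<^sup>2) = (\<Sum>j<k. (c j)\<^sup>2)\<^sup>2"
    unfolding cc[symmetric] by (simp add: split_beta)
  finally have "(\<Sum>p<k. \<Sum>q<k. c p * d p q * c q)\<^sup>2 \<le> (\<epsilon> * (\<Sum>j<k. (c j)\<^sup>2))\<^sup>2"
    by (simp add: power_mult_distrib mult.commute)
  then show ?thesis
    by (rule abs_le_square_iff[THEN iffD2, THEN order_trans]) (simp add: assms sum_nonneg)
qed

lemma space_stS [simp]: "space stS = UNIV"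
  by (simp add: stS_def space_pair_measure)

section \<open>One-period marginals of a stationary Markov panel\<close>

locale stationary_panel = prob_space M
  for M :: "'w measure" +
  fixes Y :: "nat \<Rightarrow> nat \<Rightarrow> 'w \<Rightarrow> 'a::finite \<times> 'x::euclidean_space"
    and \<pi> :: "('a \<times> 'x) measure" and K :: "'a \<times> 'x \<Rightarrow> ('a \<times> 'x) measure" and T :: nat
  assumes T: "2 \<le> T"
    and \<pi>: "\<pi> \<in> space (prob_algebra stS)"
    and K: "K \<in> stS \<rightarrow>\<^sub>M prob_algebra stS"
    and stationary: "\<pi> \<bind> K = \<pi>"
    and Y_meas [measurable]: "\<And>i t. Y i t \<in> M \<rightarrow>\<^sub>M stS"
    and Y_indep: "indep_vars (\<lambda>_. \<Pi>\<^sub>M t\<in>{1..T}. stS) (\<lambda>i \<omega>. restrict (\<lambda>t. Y i t \<omega>) {1..T}) UNIV"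
    and Y_markov: "\<And>i B. (\<And>t. B t \<in> sets stS) \<Longrightarrow>
        prob {\<omega> \<in> space M. \<forall>t\<in>{1..T}. Y i t \<omega> \<in> B t}
          = (\<integral>s. indicator (B 1) s * fdd K B 1 (T - 1) s \<partial>\<pi>)"
begin

lemma sets_\<pi> [measurable_cong, simp]: "sets \<pi> = sets stS"
  using \<pi> by (simp add: space_prob_algebra)

lemma space_\<pi> [simp]: "space \<pi> = UNIV"
  using sets_eq_imp_space_eq[OF sets_\<pi>] by simp

lemma prob_space_\<pi>: "prob_space \<pi>"
  using \<pi> by (simp add: space_prob_algebra)

lemma K_in: "K s \<in> space (prob_algebra stS)"
  using measurable_space[OF K] by simp

lemma sets_K [simp]: "sets (K s) = sets stS"
  using K_in[of s] by (simp add: space_prob_algebra)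

lemma space_K [simp]: "space (K s) = UNIV"
  using sets_eq_imp_space_eq[OF sets_K] by simp

lemma prob_space_K: "prob_space (K s)"
  using K_in[of s] by (simp add: space_prob_algebra)

lemma fdd_properties:
  assumes B: "\<And>t. B t \<in> sets stS"
  shows "fdd K B t m \<in> borel_measurable stS" "0 \<le> fdd K B t m s" "fdd K B t m s \<le> 1"
proof -
  have *: "fdd K B t m \<in> borel_measurable stS \<and> (\<forall>s. 0 \<le> fdd K B t m s \<and> fdd K B t m s \<le> 1)" for t
  proof (induction m arbitrary: t)
    case 0
    then show ?case by (simp add: fun_eq_iff cong: measurable_cong)
  next
    case (Suc m)
    let ?F = "\<lambda>s'. indicator (B (Suc t)) s' * fdd K B (Suc t) m s'"
    have Fm: "?F \<in> borel_measurable stS" using Suc B by (intro borel_measurable_times borel_measurable_indicator) auto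
    have F: "0 \<le> ?F s \<and> ?F s \<le> 1" for s
    proof -
      have "0 \<le> fdd K B (Suc t) m s \<and> fdd K B (Suc t) m s \<le> 1" using Suc by blast
      then show ?thesis by (auto simp: indicator_def)
    qed
    have "(\<lambda>s. integral\<^sup>L (K s) ?F) \<in> borel_measurable stS"
      by (rule measurable_compose[OF measurable_prob_algebraD[OF K] integral_measurable_subprob_algebra[OF Fm]])
    moreover have "0 \<le> integral\<^sup>L (K s) ?F \<and> integral\<^sup>L (K s) ?F \<le> 1" for s
    proof -
      interpret K: prob_space "K s" by (rule prob_space_K)
      have "?F \<in> borel_measurable (K s)" using Fm by (simp cong: measurable_cong_sets)
      then have "integrable (K s) ?F" by (rule K.integrable_const_bound[of _ 1, rotated]) (use F in auto)
      then have "integral\<^sup>L (K s) ?F \<le> (\<integral>s'. 1 \<partial>K s)" by (rule integral_mono) (use F in auto)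
      moreover have "K.prob UNIV = 1" using K.prob_space by simp
      ultimately show ?thesis using F by (auto intro!: integral_nonneg_AE)
    qed
    moreover have "fdd K B t (Suc m) = (\<lambda>s. integral\<^sup>L (K s) ?F)" by (simp add: fun_eq_iff)
    ultimately show ?case by simp
  qed
  show "fdd K B t m \<in> borel_measurable stS" "0 \<le> fdd K B t m s" "fdd K B t m s \<le> 1"
    using * by blast+
qed

lemma fdd_UNIV:
  assumes "\<And>u. t < u \<Longrightarrow> B u = UNIV"
  shows "fdd K B t m s = 1"
  using assms
proof (induction m arbitrary: t s)
  case (Suc m)
  interpret K: prob_space "K s" by (rule prob_space_K)
  have "fdd K B (Suc t) m s' = 1" for s' by (rule Suc.IH) (use Suc.prems in auto)
  then show ?case using Suc.prems[of "Suc t"] K.prob_space by simp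
qed simp

text \<open>Only period \<open>v\<close> is constrained. Periods after \<open>v\<close> integrate to
  one, and an unconstrained period before \<open>v\<close> is absorbed by
  \<open>\<pi> \<bind> K = \<pi>\<close>, which moves the start from \<open>t\<close> to
  \<open>Suc t\<close>.\<close>

lemma fdd_marginal:
  assumes B: "\<And>t. B t \<in> sets stS" and U: "\<And>u. u \<noteq> v \<Longrightarrow> B u = UNIV" and v: "t \<le> v" "v \<le> t + m"
  shows "(\<integral>s. indicator (B t) s * fdd K B t m s \<partial>\<pi>) = measure \<pi> (B v)"
  using v
proof (induction m arbitrary: t)
  case 0
  then show ?case using B[of v] by simp
next
  case (Suc m)
  show ?case
  proof (cases "t = v")
    case True
    have "fdd K B t (Suc m) s = 1" for s by (rule fdd_UNIV) (use U True in auto)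
    then show ?thesis using B[of v] True by (simp del: fdd.simps)
  next
    case False
    let ?F = "\<lambda>s'. indicator (B (Suc t)) s' * fdd K B (Suc t) m s'"
    interpret \<pi>: prob_space \<pi> by (rule prob_space_\<pi>)
    have "(\<integral>s. indicator (B t) s * fdd K B t (Suc m) s \<partial>\<pi>) = (\<integral>s. integral\<^sup>L (K s) ?F \<partial>\<pi>)"
      using U[OF False] by simp
    also have "\<dots> = integral\<^sup>L (\<pi> \<bind> K) ?F"
    proof (rule integral_bind[symmetric, where B = 1 and B' = 1])
      show "?F \<in> borel_measurable stS"
        using B fdd_properties(1)[OF B] by (intro borel_measurable_times borel_measurable_indicator) auto
      show "\<bar>?F x\<bar> \<le> 1" for x using fdd_properties(2,3)[of B "Suc t" m x, OF B] by (simp add: indicator_def)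
      show "K \<in> \<pi> \<rightarrow>\<^sub>M subprob_algebra stS"
        using measurable_prob_algebraD[OF K] by (simp add: measurable_cong_sets[OF sets_\<pi> refl])
      show "finite_measure \<pi>" by unfold_locales
      show "AE x in \<pi>. emeasure (K x) (space (K x)) \<le> ennreal 1"
        using prob_space.emeasure_space_1[OF prob_space_K] by simp
    qed
    also have "\<dots> = measure \<pi> (B v)"
      unfolding stationary by (rule Suc.IH) (use Suc.prems False in auto)
    finally show ?thesis .
  qed
qed

lemma distr_Y:
  assumes t: "t \<in> {1..T}"
  shows "distr M stS (Y i t) = \<pi>"
proof (rule measure_eqI)
  fix A assume "A \<in> sets (distr M stS (Y i t))"
  then have A: "A \<in> sets stS" by simp
  interpret \<pi>: prob_space \<pi> by (rule prob_space_\<pi>)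
  \<comment> \<open>Constraining a single period turns the trajectory formula into a statement about
    one marginal.\<close>
  define B where "B u = (if u = t then A else UNIV)" for u
  have UNIV: "(UNIV :: ('a \<times> 'x) set) \<in> sets stS"
    using sets.top[of "stS :: ('a \<times> 'x) measure"] by simp
  have B: "B u \<in> sets stS" for u using A UNIV by (simp add: B_def)
  have "{\<omega> \<in> space M. \<forall>u\<in>{1..T}. Y i u \<omega> \<in> B u} = Y i t -` A \<inter> space M"
    using t by (auto simp: B_def)
  then have "prob (Y i t -` A \<inter> space M) = (\<integral>s. indicator (B 1) s * fdd K B 1 (T - 1) s \<partial>\<pi>)"
    using Y_markov[where B = B and i = i, OF B] by simp
  also have "\<dots> = measure \<pi> (B t)" by (rule fdd_marginal) (use B t in \<open>auto simp: B_def\<close>)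
  finally have "prob (Y i t -` A \<inter> space M) = measure \<pi> A" by (simp add: B_def)
  then show "emeasure (distr M stS (Y i t)) A = emeasure \<pi> A"
    using A by (simp add: emeasure_distr emeasure_eq_measure \<pi>.emeasure_eq_measure)
qed simp

lemma expectation_Y:
  fixes u :: "'a \<times> 'x \<Rightarrow> real"
  assumes "t \<in> {1..T}" "u \<in> borel_measurable stS"
  shows "expectation (\<lambda>\<omega>. u (Y i t \<omega>)) = integral\<^sup>L \<pi> u"
  using integral_distr[OF Y_meas assms(2)] distr_Y[OF assms(1)] by metis

lemma AE_Y:
  assumes t: "t \<in> {1..T}" and P: "AE s in \<pi>. P s"
  shows "AE \<omega> in M. P (Y i t \<omega>)"
  by (rule AE_distrD[OF Y_meas]) (unfold distr_Y[OF t], rule P)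

section \<open>Mean and fluctuation of the sample TD matrix\<close>

context
  fixes f :: "nat \<Rightarrow> 'a \<times> 'x \<Rightarrow> real" and k :: nat and b \<beta> :: real
  assumes f [measurable]: "\<And>j. f j \<in> borel_measurable stS"
    and bound: "\<And>j. j < k \<Longrightarrow> AE s in \<pi>. \<bar>f j s\<bar> \<le> b"
    and b: "0 \<le> b" and \<beta>: "0 < \<beta>" "\<beta> < 1"
begin

text \<open>The contribution of one individual to an entry of the matrix. Averaging over the
  dependent periods first leaves summands that are independent in \<open>i\<close>.\<close>

definition unit_mean :: "nat \<Rightarrow> nat \<Rightarrow> nat \<Rightarrow> 'w \<Rightarrow> real" where
  "unit_mean p q i \<omega> =
    (\<Sum>t\<in>{1..T-1}. f p (Y i t \<omega>) * (f q (Y i t \<omega>) - \<beta> * f q (Y i (Suc t) \<omega>))) / (real T - 1)"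

lemma tdmat_eq_average:
  assumes "p < k" "q < k"
  shows "tdmat T n (\<lambda>i t. Y i t \<omega>) \<beta> k f $$ (p, q) = (\<Sum>i<n. unit_mean p q i \<omega>) / n"
  using assms by (simp add: tdmat_def En_def unit_mean_def sum_divide_distrib[symmetric] mult.commute)

lemma unit_mean_bounded:
  assumes "p < k" "q < k"
  shows "AE \<omega> in M. \<bar>unit_mean p q i \<omega>\<bar> \<le> 2 * b\<^sup>2"
proof -
  have "AE \<omega> in M. \<forall>t\<in>{1..T}. \<bar>f p (Y i t \<omega>)\<bar> \<le> b \<and> \<bar>f q (Y i t \<omega>)\<bar> \<le> b"
    using AE_Y[OF _ bound[OF assms(1)]] AE_Y[OF _ bound[OF assms(2)]]
    by (intro AE_ball_countable[THEN iffD2] ballI AE_conjI) auto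
  then show ?thesis
  proof eventually_elim
    case (elim \<omega>)
    have T1: "real (T - 1) = real T - 1" using T by (simp add: of_nat_diff)
    have term_le: "\<bar>f p (Y i t \<omega>) * (f q (Y i t \<omega>) - \<beta> * f q (Y i (Suc t) \<omega>))\<bar> \<le> 2 * b\<^sup>2" if t: "t \<in> {1..T-1}" for t
    proof -
      have t': "t \<in> {1..T}" "Suc t \<in> {1..T}" using t by auto
      have 1: "\<bar>f p (Y i t \<omega>)\<bar> \<le> b" "\<bar>f q (Y i t \<omega>)\<bar> \<le> b" "\<bar>f q (Y i (Suc t) \<omega>)\<bar> \<le> b"
        using elim t' by blast+
      have "\<bar>\<beta> * f q (Y i (Suc t) \<omega>)\<bar> \<le> 1 * b"
        unfolding abs_mult using 1 \<beta> by (intro mult_mono) auto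
      then have "\<bar>f q (Y i t \<omega>) - \<beta> * f q (Y i (Suc t) \<omega>)\<bar> \<le> 2 * b" using 1 by linarith
      then have "\<bar>f p (Y i t \<omega>) * (f q (Y i t \<omega>) - \<beta> * f q (Y i (Suc t) \<omega>))\<bar> \<le> b * (2 * b)"
        unfolding abs_mult using 1 b by (intro mult_mono) auto
      then show ?thesis by (simp add: power2_eq_square)
    qed
    have "\<bar>\<Sum>t\<in>{1..T-1}. f p (Y i t \<omega>) * (f q (Y i t \<omega>) - \<beta> * f q (Y i (Suc t) \<omega>))\<bar>
        \<le> (\<Sum>t\<in>{1..T-1}. 2 * b\<^sup>2)"
      by (rule order_trans[OF sum_abs sum_mono]) (rule term_le)
    also have "\<dots> = (real T - 1) * (2 * b\<^sup>2)" using T1 by simp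
    finally show ?case using T by (simp add: unit_mean_def pos_divide_le_eq mult.commute)
  qed
qed

lemma indep_unit_mean:
  "indep_vars (\<lambda>_. borel) (unit_mean p q) UNIV"
proof -
  define W where "W y = (\<Sum>t\<in>{1..T-1}. f p (y t) * (f q (y t) - \<beta> * f q (y (Suc t)))) / (real T - 1)"
    for y :: "nat \<Rightarrow> 'a \<times> 'x"
  have comp: "(\<lambda>y. f j (y t)) \<in> borel_measurable (\<Pi>\<^sub>M t\<in>{1..T}. stS)" if "t \<in> {1..T}" for j t
    using measurable_component_singleton[OF that] f by (rule measurable_compose)
  have "W \<in> borel_measurable (\<Pi>\<^sub>M t\<in>{1..T}. stS)"
    unfolding W_def
    by (intro borel_measurable_divide borel_measurable_sum borel_measurable_times borel_measurable_diff
        borel_measurable_const comp) auto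
  then have "indep_vars (\<lambda>_. borel) (\<lambda>i \<omega>. W (restrict (\<lambda>t. Y i t \<omega>) {1..T})) UNIV"
    by (intro indep_vars_compose2[OF Y_indep])
  also have "(\<lambda>i \<omega>. W (restrict (\<lambda>t. Y i t \<omega>) {1..T})) = unit_mean p q"
    unfolding W_def unit_mean_def fun_eq_iff by (auto intro!: arg_cong2[where f = "(/)"] sum.cong)
  finally show ?thesis .
qed

lemma integrable_unit_mean:
  assumes "p < k" "q < k"
  shows "integrable M (unit_mean p q i)"
  by (rule integrable_const_bound[of _ "2 * b\<^sup>2"])
     (use unit_mean_bounded[OF assms] indep_unit_mean in \<open>auto simp: indep_vars_def\<close>)

text \<open>Only the one-period marginals enter, so the joint law of consecutive periods is never computed.\<close>

lemma mean_form_ge: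
  fixes c :: "nat \<Rightarrow> real"
  shows "(1 - \<beta>) * (\<Sum>p<k. \<Sum>q<k. c p * gram \<pi> k f $$ (p, q) * c q)
    \<le> (\<Sum>p<k. \<Sum>q<k. c p * expectation (unit_mean p q i) * c q)"
proof -
  interpret \<pi>: prob_space \<pi> by (rule prob_space_\<pi>)
  define u where "u s = (\<Sum>p<k. c p * f p s)" for s
  have um [measurable]: "u \<in> borel_measurable stS" unfolding u_def by measurable
  have "AE s in \<pi>. \<forall>j\<in>{..<k}. \<bar>f j s\<bar> \<le> b"
    using bound by (intro AE_ball_countable[THEN iffD2]) auto
  then have ub: "AE s in \<pi>. (u s)\<^sup>2 \<le> (\<Sum>p<k. \<bar>c p\<bar> * b)\<^sup>2"
  proof eventually_elim
    case (elim s)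
    have "\<bar>u s\<bar> \<le> (\<Sum>p<k. \<bar>c p\<bar> * b)"
      unfolding u_def by (rule order_trans[OF sum_abs sum_mono]) (use elim in \<open>auto simp: abs_mult intro!: mult_left_mono\<close>)
    then show ?case by (metis abs_ge_zero power2_abs power_mono)
  qed
  have prod_int: "integrable \<pi> (\<lambda>s. f p s * f q s)" if "p < k" "q < k" for p q
  proof (rule \<pi>.integrable_const_bound[of _ "b * b"])
    show "AE s in \<pi>. norm (f p s * f q s) \<le> b * b"
      using bound[OF that(1)] bound[OF that(2)]
      by eventually_elim (auto simp: abs_mult intro!: mult_mono b)
  qed measurable
  have "(\<Sum>p<k. \<Sum>q<k. c p * gram \<pi> k f $$ (p, q) * c q) = (\<Sum>p<k. \<Sum>q<k. \<integral>s. c p * (f p s * f q s) * c q \<partial>\<pi>)"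
    by (intro sum.cong refl) (simp add: gram_def)
  also have "\<dots> = (\<integral>s. (\<Sum>p<k. \<Sum>q<k. c p * (f p s * f q s) * c q) \<partial>\<pi>)"
    by (rule integral_double_sum[symmetric]) (intro integrable_mult_left integrable_mult_right prod_int)
  also have "(\<lambda>s. \<Sum>p<k. \<Sum>q<k. c p * (f p s * f q s) * c q) = (\<lambda>s. (u s)\<^sup>2)"
    by (simp add: u_def power2_eq_square sum_product mult_ac)
  finally have gram: "(\<Sum>p<k. \<Sum>q<k. c p * gram \<pi> k f $$ (p, q) * c q) = (\<integral>s. (u s)\<^sup>2 \<partial>\<pi>)" .
  have T1: "0 < real T - 1" "real (T - 1) = real T - 1" using T by (simp_all add: of_nat_diff)
  \<comment> \<open>The quadratic form of the individual's matrix collapses to the scalar function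
    \<open>u\<close>, the combination of basis functions with weights \<open>c\<close>.\<close>
  define W where "W \<omega> = (\<Sum>t\<in>{1..T-1}. u (Y i t \<omega>) * (u (Y i t \<omega>) - \<beta> * u (Y i (Suc t) \<omega>))) / (real T - 1)" for \<omega>
  have W: "(\<Sum>p<k. \<Sum>q<k. c p * unit_mean p q i \<omega> * c q) = W \<omega>" for \<omega>
  proof -
    have "(\<Sum>p<k. \<Sum>q<k. c p * unit_mean p q i \<omega> * c q) =
       (\<Sum>p<k. \<Sum>q<k. \<Sum>t\<in>{1..T-1}. (c p * f p (Y i t \<omega>)) *
          (c q * f q (Y i t \<omega>) - \<beta> * (c q * f q (Y i (Suc t) \<omega>))) / (real T - 1))"
      by (intro sum.cong refl) (simp add: unit_mean_def sum_distrib_left sum_distrib_right sum_divide_distrib algebra_simps)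
    also have "\<dots> = (\<Sum>p<k. \<Sum>t\<in>{1..T-1}. \<Sum>q<k. (c p * f p (Y i t \<omega>)) *
          (c q * f q (Y i t \<omega>) - \<beta> * (c q * f q (Y i (Suc t) \<omega>))) / (real T - 1))"
      by (intro sum.cong refl sum.swap)
    also have "\<dots> = (\<Sum>t\<in>{1..T-1}. \<Sum>p<k. \<Sum>q<k. (c p * f p (Y i t \<omega>)) *
          (c q * f q (Y i t \<omega>) - \<beta> * (c q * f q (Y i (Suc t) \<omega>))) / (real T - 1))"
      by (rule sum.swap)
    also have "\<dots> = W \<omega>"
      unfolding W_def sum_divide_distrib[of _ "{1..T-1}"]
    proof (intro sum.cong refl)
      fix t
      have "u (Y i t \<omega>) - \<beta> * u (Y i (Suc t) \<omega>) =
          (\<Sum>q<k. c q * f q (Y i t \<omega>) - \<beta> * (c q * f q (Y i (Suc t) \<omega>)))"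
        by (simp add: u_def sum_subtractf sum_distrib_left)
      then show "(\<Sum>p<k. \<Sum>q<k. (c p * f p (Y i t \<omega>)) *
          (c q * f q (Y i t \<omega>) - \<beta> * (c q * f q (Y i (Suc t) \<omega>))) / (real T - 1)) =
        u (Y i t \<omega>) * (u (Y i t \<omega>) - \<beta> * u (Y i (Suc t) \<omega>)) / (real T - 1)"
        by (simp only: u_def[of "Y i t \<omega>"] sum_product sum_divide_distrib)
    qed
    finally show ?thesis .
  qed
  have Wi: "integrable M W"
    unfolding W[symmetric] by (intro Bochner_Integration.integrable_sum integrable_mult_left integrable_mult_right integrable_unit_mean) auto
  have EW: "expectation W = (\<Sum>p<k. \<Sum>q<k. c p * expectation (unit_mean p q i) * c q)"
    unfolding W[symmetric]
    by (subst integral_double_sum) (auto intro!: integrable_unit_mean sum.cong)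
  have u2: "integrable M (\<lambda>\<omega>. (u (Y i t \<omega>))\<^sup>2)" if "t \<in> {1..T}" for t
    by (rule integrable_const_bound[of _ "(\<Sum>p<k. \<bar>c p\<bar> * b)\<^sup>2"]) (use AE_Y[OF that ub] in simp_all)
  have Eu2: "expectation (\<lambda>\<omega>. (u (Y i t \<omega>))\<^sup>2) = (\<integral>s. (u s)\<^sup>2 \<partial>\<pi>)" if "t \<in> {1..T}" for t
    by (rule expectation_Y[OF that]) measurable
  \<comment> \<open>Minorant of \<open>W\<close> in which the product across two periods has been
    split into squares. By stationarity both squares have the same mean, and
    \<open>1 - \<beta> / 2\<close> minus \<open>\<beta> / 2\<close> is
    \<open>1 - \<beta>\<close>.\<close>
  define L where "L \<omega> = (\<Sum>t\<in>{1..T-1}. (1 - \<beta> / 2) * (u (Y i t \<omega>))\<^sup>2 - \<beta> / 2 * (u (Y i (Suc t) \<omega>))\<^sup>2) / (real T - 1)" for \<omega>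
  have Lterm: "integrable M (\<lambda>\<omega>. (1 - \<beta> / 2) * (u (Y i t \<omega>))\<^sup>2 - \<beta> / 2 * (u (Y i (Suc t) \<omega>))\<^sup>2)"
    "expectation (\<lambda>\<omega>. (1 - \<beta> / 2) * (u (Y i t \<omega>))\<^sup>2 - \<beta> / 2 * (u (Y i (Suc t) \<omega>))\<^sup>2) = (1 - \<beta>) * (\<integral>s. (u s)\<^sup>2 \<partial>\<pi>)"
    if "t \<in> {1..T-1}" for t
  proof -
    have t: "t \<in> {1..T}" "Suc t \<in> {1..T}" using that by auto
    show "integrable M (\<lambda>\<omega>. (1 - \<beta> / 2) * (u (Y i t \<omega>))\<^sup>2 - \<beta> / 2 * (u (Y i (Suc t) \<omega>))\<^sup>2)"
      using u2[OF t(1)] u2[OF t(2)] by simp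
    show "expectation (\<lambda>\<omega>. (1 - \<beta> / 2) * (u (Y i t \<omega>))\<^sup>2 - \<beta> / 2 * (u (Y i (Suc t) \<omega>))\<^sup>2) = (1 - \<beta>) * (\<integral>s. (u s)\<^sup>2 \<partial>\<pi>)"
      using u2[OF t(1)] u2[OF t(2)] Eu2[OF t(1)] Eu2[OF t(2)] by (simp add: algebra_simps)
  qed
  have Li: "integrable M L"
    unfolding L_def by (rule integrable_divide_zero, rule Bochner_Integration.integrable_sum, rule Lterm(1))
  have EL: "expectation L = (1 - \<beta>) * (\<integral>s. (u s)\<^sup>2 \<partial>\<pi>)"
  proof -
    have "expectation L = (\<Sum>t\<in>{1..T-1}. (1 - \<beta>) * (\<integral>s. (u s)\<^sup>2 \<partial>\<pi>)) / (real T - 1)"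
      unfolding L_def integral_divide_zero
      by (rule arg_cong2[where f = "(/)", OF trans[OF Bochner_Integration.integral_sum sum.cong[OF refl Lterm(2)]] refl])
         (rule Lterm(1))
    then show ?thesis using T1 by simp
  qed
  have "L \<omega> \<le> W \<omega>" for \<omega>
    unfolding L_def W_def
  proof (intro divide_right_mono sum_mono)
    fix t
    let ?x = "u (Y i t \<omega>)" and ?y = "u (Y i (Suc t) \<omega>)"
    have "0 \<le> \<beta> / 2 * (?x - ?y)\<^sup>2" using \<beta> by simp
    then show "(1 - \<beta> / 2) * ?x\<^sup>2 - \<beta> / 2 * ?y\<^sup>2 \<le> ?x * (?x - \<beta> * ?y)"
      by (simp add: power2_eq_square algebra_simps)
  qed (use T1 in simp)
  then have "expectation L \<le> expectation W" by (intro integral_mono Li Wi)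
  then show ?thesis unfolding EL EW gram .
qed

text \<open>Markov's inequality for the squared Frobenius distance. The constant
  \<open>4 * b^4\<close> is the square of the almost sure bound \<open>2 * b\<^sup>2\<close> on
  \<open>unit_mean\<close>, and \<open>(real k)\<^sup>2\<close> counts the entries. Here
  \<open>\<epsilon>\<close> is a threshold for the squared distance.\<close>

lemma tdmat_deviation:
  assumes e: "0 < \<epsilon>" and n: "0 < n"
  defines "d \<equiv> \<lambda>p q \<omega>. tdmat T n (\<lambda>i t. Y i t \<omega>) \<beta> k f $$ (p, q)
    - (\<Sum>i<n. expectation (unit_mean p q i)) / n"
  defines "B \<equiv> {\<omega> \<in> space M. \<epsilon> \<le> (\<Sum>p<k. \<Sum>q<k. (d p q \<omega>)\<^sup>2)}"
  shows "B \<in> events" "prob B \<le> 4 * b^4 * (real k)\<^sup>2 / (n * \<epsilon>)"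
proof -
  have d: "d p q \<omega> = (\<Sum>i<n. unit_mean p q i \<omega> - expectation (unit_mean p q i)) / n"
    if "p < k" "q < k" for p q \<omega>
    unfolding d_def tdmat_eq_average[OF that] by (simp add: sum_subtractf diff_divide_distrib)
  have dm: "integrable M (\<lambda>\<omega>. (d p q \<omega>)\<^sup>2)" "expectation (\<lambda>\<omega>. (d p q \<omega>)\<^sup>2) \<le> 4 * b^4 / n"
    if "p < k" "q < k" for p q
  proof -
    note v = variance_sum_indep_bounded[OF indep_unit_mean unit_mean_bounded[OF that], of n]
    show "integrable M (\<lambda>\<omega>. (d p q \<omega>)\<^sup>2)"
      unfolding d[OF that] power_divide using v(2) by simp
    have "expectation (\<lambda>\<omega>. (d p q \<omega>)\<^sup>2) \<le> n * (2 * b\<^sup>2)\<^sup>2 / n\<^sup>2"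
      unfolding d[OF that] power_divide using v(1) by (simp add: divide_right_mono)
    also have "\<dots> = 4 * b^4 / n" using n by (simp add: power2_eq_square power4_eq_xxxx field_simps)
    finally show "expectation (\<lambda>\<omega>. (d p q \<omega>)\<^sup>2) \<le> 4 * b^4 / n" .
  qed
  let ?S = "\<lambda>\<omega>. \<Sum>p<k. \<Sum>q<k. (d p q \<omega>)\<^sup>2"
  have Si: "integrable M ?S" using dm(1) by (intro Bochner_Integration.integrable_sum) auto
  have Sm [measurable]: "?S \<in> borel_measurable M" using Si by (rule borel_measurable_integrable)
  show "B \<in> events" unfolding B_def by measurable
  have "expectation ?S = (\<Sum>p<k. \<Sum>q<k. expectation (\<lambda>\<omega>. (d p q \<omega>)\<^sup>2))"
    by (rule integral_double_sum) (rule dm(1))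
  also have "\<dots> \<le> (\<Sum>p<k. \<Sum>q<k. 4 * b^4 / n)" by (intro sum_mono) (use dm(2) in auto)
  also have "\<dots> = 4 * b^4 * (real k)\<^sup>2 / n" by (simp add: power2_eq_square)
  finally have ES: "expectation ?S \<le> 4 * b^4 * (real k)\<^sup>2 / n" .
  have "prob B \<le> expectation ?S / \<epsilon>"
    unfolding B_def by (rule integral_Markov_inequality_measure[OF Si sets.top]) (auto intro!: AE_I2 sum_nonneg e)
  also have "\<dots> \<le> 4 * b^4 * (real k)\<^sup>2 / n / \<epsilon>" using ES e by (intro divide_right_mono) auto
  finally show "prob B \<le> 4 * b^4 * (real k)\<^sup>2 / (n * \<epsilon>)" by simp
qed

text \<open>The averaged expectation is coercive with constant \<open>2 * \<epsilon>\<close>, which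
  is \<open>1 - \<beta>\<close> times the eigenvalue bound \<open>c0\<close>. A deviation of
  Frobenius norm below \<open>\<epsilon>\<close> costs half of it, and the other half is left for
  the sample matrix.\<close>

lemma tdmat_coercive:
  assumes c0: "0 < c0" and ev: "\<And>\<mu>. eigenvalue (gram \<pi> k f) \<mu> \<Longrightarrow> c0 \<le> \<mu>" and n: "0 < n"
  defines "\<epsilon> \<equiv> (1 - \<beta>) * c0 / 2"
  obtains E where "E \<in> events" "1 - 4 * b^4 * (real k)\<^sup>2 / (n * \<epsilon>\<^sup>2) \<le> prob E"
    "\<And>\<omega> c. \<omega> \<in> E \<Longrightarrow> \<epsilon> * (\<Sum>j<k. (c j)\<^sup>2)
      \<le> (\<Sum>p<k. \<Sum>q<k. c p * tdmat T n (\<lambda>i t. Y i t \<omega>) \<beta> k f $$ (p, q) * c q)"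
proof -
  have e: "0 < \<epsilon>" using c0 \<beta> by (simp add: \<epsilon>_def)
  define a where "a p q = (\<Sum>i<n. expectation (unit_mean p q i)) / n" for p q
  define d where "d p q \<omega> = tdmat T n (\<lambda>i t. Y i t \<omega>) \<beta> k f $$ (p, q) - a p q" for p q \<omega>
  define B where "B = {\<omega> \<in> space M. \<epsilon>\<^sup>2 \<le> (\<Sum>p<k. \<Sum>q<k. (d p q \<omega>)\<^sup>2)}"
  have B: "B \<in> events" "prob B \<le> 4 * b^4 * (real k)\<^sup>2 / (n * \<epsilon>\<^sup>2)"
    using tdmat_deviation[of "\<epsilon>\<^sup>2" n] e n by (simp_all add: B_def d_def a_def)
  have gram_eq: "gram \<pi> k f = mat k k (\<lambda>(p, q). \<integral>s. f p s * f q s \<partial>\<pi>)" by (simp add: gram_def)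
  have gram: "c0 * (\<Sum>j<k. (c j)\<^sup>2) \<le> (\<Sum>p<k. \<Sum>q<k. c p * gram \<pi> k f $$ (p, q) * c q)" for c
  proof -
    have "c0 * (\<Sum>j<k. (c j)\<^sup>2) \<le> (\<Sum>p<k. \<Sum>q<k. c p * (\<integral>s. f p s * f q s \<partial>\<pi>) * c q)"
      using ev unfolding gram_eq by (intro quadratic_form_ge_eigenvalue_bound) (simp_all add: mult.commute)
    also have "\<dots> = (\<Sum>p<k. \<Sum>q<k. c p * gram \<pi> k f $$ (p, q) * c q)"
      by (intro sum.cong refl) (simp add: gram_def)
    finally show ?thesis .
  qed
  have a: "2 * \<epsilon> * (\<Sum>j<k. (c j)\<^sup>2) \<le> (\<Sum>p<k. \<Sum>q<k. c p * a p q * c q)" for c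
  proof -
    have "(\<Sum>i<n. 2 * \<epsilon> * (\<Sum>j<k. (c j)\<^sup>2)) \<le> (\<Sum>i<n. \<Sum>p<k. \<Sum>q<k. c p * expectation (unit_mean p q i) * c q)"
    proof (intro sum_mono)
      fix i
      have "2 * \<epsilon> * (\<Sum>j<k. (c j)\<^sup>2) = (1 - \<beta>) * (c0 * (\<Sum>j<k. (c j)\<^sup>2))" by (simp add: \<epsilon>_def)
      also have "\<dots> \<le> (1 - \<beta>) * (\<Sum>p<k. \<Sum>q<k. c p * gram \<pi> k f $$ (p, q) * c q)"
        using gram \<beta> by (intro mult_left_mono) auto
      finally show "2 * \<epsilon> * (\<Sum>j<k. (c j)\<^sup>2) \<le> (\<Sum>p<k. \<Sum>q<k. c p * expectation (unit_mean p q i) * c q)"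
        using mean_form_ge[of c i] by linarith
    qed
    also have "\<dots> = (\<Sum>p<k. \<Sum>i<n. \<Sum>q<k. c p * expectation (unit_mean p q i) * c q)" by (rule sum.swap)
    also have "\<dots> = (\<Sum>p<k. \<Sum>q<k. \<Sum>i<n. c p * expectation (unit_mean p q i) * c q)"
      by (intro sum.cong refl sum.swap)
    also have "\<dots> = n * (\<Sum>p<k. \<Sum>q<k. c p * a p q * c q)"
      unfolding sum_distrib_left[of "real n"]
      by (intro sum.cong refl) (use n in \<open>simp add: a_def sum_distrib_left[symmetric] sum_distrib_right[symmetric]\<close>)
    finally show ?thesis using n by simp
  qed
  show ?thesis
  proof (rule that[of "space M - B"])
    show "space M - B \<in> events" using B by simp
    show "1 - 4 * b^4 * (real k)\<^sup>2 / (n * \<epsilon>\<^sup>2) \<le> prob (space M - B)" using B by (simp add: prob_compl)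
    fix \<omega> c assume \<omega>: "\<omega> \<in> space M - B"
    have "\<bar>\<Sum>p<k. \<Sum>q<k. c p * d p q \<omega> * c q\<bar> \<le> \<epsilon> * (\<Sum>j<k. (c j)\<^sup>2)"
      by (rule bilinear_perturbation) (use \<omega> e in \<open>auto simp: B_def\<close>)
    moreover have "(\<Sum>p<k. \<Sum>q<k. c p * tdmat T n (\<lambda>i t. Y i t \<omega>) \<beta> k f $$ (p, q) * c q) =
        (\<Sum>p<k. \<Sum>q<k. c p * a p q * c q) + (\<Sum>p<k. \<Sum>q<k. c p * d p q \<omega> * c q)"
      by (simp add: sum.distrib[symmetric] d_def algebra_simps)
    ultimately show "\<epsilon> * (\<Sum>j<k. (c j)\<^sup>2)
        \<le> (\<Sum>p<k. \<Sum>q<k. c p * tdmat T n (\<lambda>i t. Y i t \<omega>) \<beta> k f $$ (p, q) * c q)"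
      using a[of c] by linarith
  qed
qed

end

text \<open>The bounds \<open>b\<close> and \<open>c0\<close> are uniform in \<open>n\<close>, so
  the failure probability is a constant times \<open>(real (k n))\<^sup>2 / n\<close>. For
  \<open>n = 0\<close> there is no observation to draw; \<open>E 0 = {}\<close> excludes that case,
  at no cost in the limit.\<close>

lemma tdmat_coercive_whp:
  fixes f :: "nat \<Rightarrow> nat \<Rightarrow> 'a \<times> 'x \<Rightarrow> real" and k :: "nat \<Rightarrow> nat"
  assumes f: "\<And>n j. f n j \<in> borel_measurable stS"
    and bound: "\<And>n j. j < k n \<Longrightarrow> AE s in \<pi>. \<bar>f n j s\<bar> \<le> b" and b: "0 \<le> b"
    and \<beta>: "0 < \<beta>" "\<beta> < 1"
    and c0: "0 < c0" and ev: "\<And>n \<mu>. eigenvalue (gram \<pi> (k n) (f n)) \<mu> \<Longrightarrow> c0 \<le> \<mu>"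
    and k: "(\<lambda>n. (real (k n))\<^sup>2 / n) \<longlonglongrightarrow> 0"
  obtains E where "\<And>n. E n \<in> events" "(\<lambda>n. prob (E n)) \<longlonglongrightarrow> 1" "E 0 = {}"
    "\<And>n \<omega> c. \<omega> \<in> E n \<Longrightarrow> (1 - \<beta>) * c0 / 2 * (\<Sum>j<k n. (c j)\<^sup>2)
      \<le> (\<Sum>p<k n. \<Sum>q<k n. c p * tdmat T n (\<lambda>i t. Y i t \<omega>) \<beta> (k n) (f n) $$ (p, q) * c q)"
proof -
  let ?\<epsilon> = "(1 - \<beta>) * c0 / 2"
  \<comment> \<open>All requirements on the event for sample size \<open>n\<close> are collected in
    one predicate, so that a single choice yields the whole sequence.\<close>
  define good where "good n E \<longleftrightarrow> E \<in> events \<and>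
      (0 < n \<longrightarrow> 1 - 4 * b^4 * (real (k n))\<^sup>2 / (n * ?\<epsilon>\<^sup>2) \<le> prob E) \<and> (n = 0 \<longrightarrow> E = {}) \<and>
      (\<forall>\<omega>\<in>E. \<forall>c. ?\<epsilon> * (\<Sum>j<k n. (c j)\<^sup>2)
        \<le> (\<Sum>p<k n. \<Sum>q<k n. c p * tdmat T n (\<lambda>i t. Y i t \<omega>) \<beta> (k n) (f n) $$ (p, q) * c q))" for n E
  have "\<exists>E. good n E" for n
  proof (cases "n = 0")
    case True
    then show ?thesis unfolding good_def by (intro exI[of _ "{}"]) simp
  next
    case False
    show ?thesis
      unfolding good_def
      by (rule tdmat_coercive[of "f n" "k n" b \<beta> c0 n, OF f bound b \<beta> c0 ev])
         (use False in \<open>blast+\<close>)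
  qed
  then obtain E where good: "\<And>n. good n (E n)" by metis
  have E: "\<And>n. E n \<in> events" "E 0 = {}"
      "\<And>n \<omega> c. \<omega> \<in> E n \<Longrightarrow> ?\<epsilon> * (\<Sum>j<k n. (c j)\<^sup>2)
        \<le> (\<Sum>p<k n. \<Sum>q<k n. c p * tdmat T n (\<lambda>i t. Y i t \<omega>) \<beta> (k n) (f n) $$ (p, q) * c q)"
    using good unfolding good_def by blast+
  have prob_ge: "1 - 4 * b^4 * (real (k n))\<^sup>2 / (n * ?\<epsilon>\<^sup>2) \<le> prob (E n)" if "0 < n" for n
    using good[of n] that unfolding good_def by blast
  have "(\<lambda>n. 1 - 4 * b^4 / ?\<epsilon>\<^sup>2 * ((real (k n))\<^sup>2 / n)) \<longlonglongrightarrow> 1 - 4 * b^4 / ?\<epsilon>\<^sup>2 * 0"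
    by (intro tendsto_intros k)
  then have lim: "(\<lambda>n. 1 - 4 * b^4 / ?\<epsilon>\<^sup>2 * ((real (k n))\<^sup>2 / n)) \<longlonglongrightarrow> 1" by simp
  have "(\<lambda>n. prob (E n)) \<longlonglongrightarrow> 1"
  proof (rule tendsto_sandwich[OF _ _ lim tendsto_const])
    show "\<forall>\<^sub>F n in sequentially. 1 - 4 * b^4 / ?\<epsilon>\<^sup>2 * ((real (k n))\<^sup>2 / n) \<le> prob (E n)"
      using eventually_gt_at_top[of 0]
    proof eventually_elim
      case (elim n)
      have "4 * b^4 / ?\<epsilon>\<^sup>2 * ((real (k n))\<^sup>2 / n) = 4 * b^4 * (real (k n))\<^sup>2 / (n * ?\<epsilon>\<^sup>2)"
        unfolding times_divide_times_eq by (simp only: mult.commute)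
      then show ?case using prob_ge[OF elim] by linarith
    qed
  qed simp
  then show ?thesis by (rule that[of E, OF E(1) _ E(2,3)])
qed

end

subsection \<open>Convergence of stochastic-gradient TD learning\<close>

theorem theorem4:
  fixes M :: "'w measure"
    and Y :: "nat \<Rightarrow> nat \<Rightarrow> 'w \<Rightarrow> 'a::finite \<times> 'x::euclidean_space"
    and \<pi> :: "('a \<times> 'x) measure"
    and K :: "'a \<times> 'x \<Rightarrow> ('a \<times> 'x) measure"
    and T :: nat and \<beta> :: real
    and z :: "'a \<times> 'x \<Rightarrow> real" and h :: "'a \<times> 'x \<Rightarrow> real"
    and \<eta> :: "'a \<Rightarrow> 'x \<Rightarrow> real" and g :: "'a \<times> 'x \<Rightarrow> real"
    and X :: "'x set"
    and k\<phi> kr :: "nat \<Rightarrow> nat"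
    and \<phi> r :: "nat \<Rightarrow> nat \<Rightarrow> 'a \<times> 'x \<Rightarrow> real"
    and \<eta>hat :: "nat \<Rightarrow> 'w \<Rightarrow> 'a \<Rightarrow> 'x \<Rightarrow> real"
    and \<alpha>\<omega> \<alpha>\<xi> :: "nat \<Rightarrow> real"
  assumes M: "prob_space M"
    and T: "T \<ge> 2"
    and \<beta>: "0 < \<beta>" "\<beta> < 1"
    \<comment> \<open>stationary Markov law with time-invariant transitions\<close>
    and \<pi>: "\<pi> \<in> space (prob_algebra stS)"
    and K: "K \<in> stS \<rightarrow>\<^sub>M prob_algebra stS"
    and stationary: "\<pi> \<bind> K = \<pi>"
    \<comment> \<open>data: individuals i.i.d., each a Markov trajectory over periods 1..T started from pi\<close>
    and Y_meas: "\<And>i t. Y i t \<in> M \<rightarrow>\<^sub>M stS"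
    and Y_indep: "prob_space.indep_vars M (\<lambda>_. \<Pi>\<^sub>M t\<in>{1..T}. stS)
                    (\<lambda>i \<omega>. restrict (\<lambda>t. Y i t \<omega>) {1..T}) UNIV"
    and Y_markov: "\<And>i B. (\<And>t. B t \<in> sets stS) \<Longrightarrow>
        measure M {\<omega> \<in> space M. \<forall>t\<in>{1..T}. Y i t \<omega> \<in> B t}
          = (\<integral>s. indicator (B 1) s * fdd K B 1 (T - 1) s \<partial>\<pi>)"
    \<comment> \<open>compact domain\<close>
    and X: "compact X" "AE s in \<pi>. snd s \<in> X"
    \<comment> \<open>eta(a,x) = P(a | x)\<close>
    and \<eta>_meas: "\<And>a. \<eta> a \<in> borel_measurable borel"
    and \<eta>_cond: "\<And>a B. B \<in> sets borel \<Longrightarrow>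
        measure \<pi> ({a} \<times> B) = (\<integral>s. indicator (UNIV \<times> B) s * \<eta> a (snd s) \<partial>\<pi>)"
    \<comment> \<open>h, g: fixed points defining them\<close>
    and z_meas: "z \<in> borel_measurable stS"
    and h_meas: "h \<in> borel_measurable stS" and h_bdd: "bounded (range h)"
    and h_fix: "AE s in \<pi>. h s = z s + \<beta> * (\<integral>s'. h s' \<partial>(K s))"
    and g_meas: "g \<in> borel_measurable stS" and g_bdd: "bounded (range g)"
    and g_fix: "AE s in \<pi>. g s = \<beta> * (\<integral>s'. (euler_mascheroni - ln (\<eta> (fst s') (snd s'))) + g s' \<partial>(K s))"
    \<comment> \<open>Assumption 1\<close>
    and \<phi>_meas: "\<And>n j. \<phi> n j \<in> borel_measurable stS"
    and A1_i_indep: "\<And>n c. (\<forall>a. \<forall>x\<in>X. (\<Sum>j<k\<phi> n. c j * \<phi> n j (a, x)) = 0) \<Longrightarrow> \<forall>j<k\<phi> n. c j = 0"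
    and A1_i_eig: "\<exists>c>0. \<forall>n ev. eigenvalue (gram \<pi> (k\<phi> n) (\<phi> n)) ev \<longrightarrow> c \<le> ev"
    and A1_ii: "\<exists>B. \<forall>n j a x. j < k\<phi> n \<longrightarrow> x \<in> X \<longrightarrow> \<bar>\<phi> n j (a, x)\<bar> \<le> B"
    and A1_iii: "\<exists>C a. a > 0 \<and> (\<forall>n. l2norm \<pi> (\<lambda>s. h s - proj \<pi> (k\<phi> n) (\<phi> n) h s)
                                     \<le> C * real (k\<phi> n) powr (- a))"
    and A1_iv: "\<exists>L. \<forall>a x. x \<in> X \<longrightarrow> \<bar>z (a, x)\<bar> \<le> L"
    and A1_v: "filterlim k\<phi> at_top sequentially"
              "(\<lambda>n. real (k\<phi> n)^2 / real n) \<longlonglongrightarrow> 0"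
    \<comment> \<open>Assumption 2\<close>
    and r_meas: "\<And>n j. r n j \<in> borel_measurable stS"
    and A2_i_indep: "\<And>n c. (\<forall>a. \<forall>x\<in>X. (\<Sum>j<kr n. c j * r n j (a, x)) = 0) \<Longrightarrow> \<forall>j<kr n. c j = 0"
    and A2_i_eig: "\<exists>c>0. \<forall>n ev. eigenvalue (gram \<pi> (kr n) (r n)) ev \<longrightarrow> c \<le> ev"
    and A2_ii: "\<exists>B. \<forall>n j a x. j < kr n \<longrightarrow> x \<in> X \<longrightarrow> \<bar>r n j (a, x)\<bar> \<le> B"
    and A2_iii: "\<exists>C a. a > 0 \<and> (\<forall>n. l2norm \<pi> (\<lambda>s. g s - proj \<pi> (kr n) (r n) g s)
                                     \<le> C * real (kr n) powr (- a))"
    and A2_iv: "\<exists>L. \<forall>a x. x \<in> X \<longrightarrow> \<bar>euler_mascheroni - ln (\<eta> a x)\<bar> \<le> L"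
    and A2_v: "filterlim kr at_top sequentially"
              "(\<lambda>n. real (kr n)^2 / real n) \<longlonglongrightarrow> 0"
    \<comment> \<open>first-step estimate of eta: strictly positive, computed from the data\<close>
    and \<eta>hat_pos: "\<And>n \<omega> a x. \<eta>hat n \<omega> a x > 0"
    \<comment> \<open>step sizes\<close>
    and \<alpha>_nonneg: "\<And>l. \<alpha>\<omega> l \<ge> 0" "\<And>l. \<alpha>\<xi> l \<ge> 0"
    and \<alpha>\<omega>_sum: "filterlim (\<lambda>m. \<Sum>l<m. \<alpha>\<omega> l) at_top sequentially"
    and \<alpha>\<omega>_sq: "summable (\<lambda>l. (\<alpha>\<omega> l)^2)"
    and \<alpha>\<xi>_sum: "filterlim (\<lambda>m. \<Sum>l<m. \<alpha>\<xi> l) at_top sequentially"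
    and \<alpha>\<xi>_sq: "summable (\<lambda>l. (\<alpha>\<xi> l)^2)"
  shows "\<exists>E :: nat \<Rightarrow> 'w set.
           (\<forall>n. E n \<in> sets M) \<and> (\<lambda>n. measure M (E n)) \<longlonglongrightarrow> 1 \<and>
           (\<forall>n. \<forall>\<omega>\<in>E n.
              let D = (\<lambda>i t. Y i t \<omega>);
                  A\<omega> = tdmat T n D \<beta> (k\<phi> n) (\<phi> n);
                  b\<omega> = vec (k\<phi> n) (\<lambda>p. En T n D (\<lambda>s s'. \<phi> n p s * z s));
                  \<omega>hat = minv A\<omega> *\<^sub>v b\<omega>;
                  ehat = (\<lambda>s. euler_mascheroni - ln (\<eta>hat n \<omega> (fst s) (snd s)));
                  A\<xi> = tdmat T n D \<beta> (kr n) (r n);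
                  b\<xi> = vec (kr n) (\<lambda>p. En T n D (\<lambda>s s'. \<beta> * r n p s * ehat s'));
                  \<xi>hat = minv A\<xi> *\<^sub>v b\<xi>
              in invertible_mat A\<omega> \<and> invertible_mat A\<xi> \<and>
                 (\<forall>w0 \<in> carrier_vec (k\<phi> n).
                    AE \<sigma> in drawM T n.
                      \<forall>j < k\<phi> n. (\<lambda>l. td \<alpha>\<omega> \<beta> (\<lambda>i t. fvec (k\<phi> n) (\<phi> n) (D i t))
                                         (\<lambda>i t. z (D i t)) w0 \<sigma> l $ j) \<longlonglongrightarrow> \<omega>hat $ j) \<and>
                 (\<forall>v0 \<in> carrier_vec (kr n).
                    AE \<sigma> in drawM T n.
                      \<forall>j < kr n. (\<lambda>l. td \<alpha>\<xi> \<beta> (\<lambda>i t. fvec (kr n) (r n) (D i t))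
                                         (\<lambda>i t. \<beta> * ehat (D i (Suc t))) v0 \<sigma> l $ j) \<longlonglongrightarrow> \<xi>hat $ j))"
proof -
  interpret P: stationary_panel M Y \<pi> K T
    by (intro stationary_panel.intro stationary_panel_axioms.intro) (fact M T \<pi> K stationary Y_meas Y_indep Y_markov)+
  \<comment> \<open>Bounds on the compact domain become almost sure bounds under
    \<open>\<pi>\<close>; the absolute value makes the constant nonnegative even when the given
    bound is not.\<close>
  have bound: "\<exists>b\<ge>0. \<forall>n j. j < k n \<longrightarrow> (AE s in \<pi>. \<bar>f n j s\<bar> \<le> b)"
    if ex: "\<exists>B. \<forall>n j a x. j < k n \<longrightarrow> x \<in> X \<longrightarrow> \<bar>f n j (a, x)\<bar> \<le> B"
    for f :: "nat \<Rightarrow> nat \<Rightarrow> 'a \<times> 'x \<Rightarrow> real" and k :: "nat \<Rightarrow> nat"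
  proof -
    obtain B where B: "\<And>n j a x. j < k n \<Longrightarrow> x \<in> X \<Longrightarrow> \<bar>f n j (a, x)\<bar> \<le> B" using ex by blast
    have "AE s in \<pi>. \<bar>f n j s\<bar> \<le> \<bar>B\<bar>" if "j < k n" for n j
      using X(2)
    proof eventually_elim
      case (elim s)
      have "\<bar>f n j (fst s, snd s)\<bar> \<le> B" using that elim by (rule B)
      then show ?case by simp
    qed
    then show ?thesis by (intro exI[of _ "\<bar>B\<bar>"]) simp
  qed
  obtain b\<phi> where b\<phi>: "0 \<le> b\<phi>" "\<And>n j. j < k\<phi> n \<Longrightarrow> AE s in \<pi>. \<bar>\<phi> n j s\<bar> \<le> b\<phi>"
    using bound[OF A1_ii] by blast
  obtain br where br: "0 \<le> br" "\<And>n j. j < kr n \<Longrightarrow> AE s in \<pi>. \<bar>r n j s\<bar> \<le> br"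
    using bound[OF A2_ii] by blast
  obtain c\<phi> where c\<phi>: "0 < c\<phi>" "\<And>n ev. eigenvalue (gram \<pi> (k\<phi> n) (\<phi> n)) ev \<Longrightarrow> c\<phi> \<le> ev"
    using A1_i_eig by blast
  obtain cr where cr: "0 < cr" "\<And>n ev. eigenvalue (gram \<pi> (kr n) (r n)) ev \<Longrightarrow> cr \<le> ev"
    using A2_i_eig by blast
  define \<epsilon>\<phi> \<epsilon>r where "\<epsilon>\<phi> = (1 - \<beta>) * c\<phi> / 2" and "\<epsilon>r = (1 - \<beta>) * cr / 2"
  have \<epsilon>: "0 < \<epsilon>\<phi>" "0 < \<epsilon>r" using \<beta> c\<phi>(1) cr(1) by (simp_all add: \<epsilon>\<phi>_def \<epsilon>r_def)
  obtain E\<phi> where E\<phi>: "\<And>n. E\<phi> n \<in> P.events" "(\<lambda>n. P.prob (E\<phi> n)) \<longlonglongrightarrow> 1" "E\<phi> 0 = {}"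
    "\<And>n \<omega> c. \<omega> \<in> E\<phi> n \<Longrightarrow> \<epsilon>\<phi> * (\<Sum>j<k\<phi> n. (c j)\<^sup>2)
      \<le> (\<Sum>p<k\<phi> n. \<Sum>q<k\<phi> n. c p * tdmat T n (\<lambda>i t. Y i t \<omega>) \<beta> (k\<phi> n) (\<phi> n) $$ (p, q) * c q)"
  proof (rule P.tdmat_coercive_whp[of \<phi> k\<phi> b\<phi> \<beta> c\<phi>, OF \<phi>_meas b\<phi>(2,1) \<beta> c\<phi> A1_v(2)], fold \<epsilon>\<phi>_def)
    fix E assume "\<And>n. E n \<in> P.events" "(\<lambda>n. P.prob (E n)) \<longlonglongrightarrow> 1" "E 0 = {}"
      "\<And>n \<omega> c. \<omega> \<in> E n \<Longrightarrow> \<epsilon>\<phi> * (\<Sum>j<k\<phi> n. (c j)\<^sup>2)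
        \<le> (\<Sum>p<k\<phi> n. \<Sum>q<k\<phi> n. c p * tdmat T n (\<lambda>i t. Y i t \<omega>) \<beta> (k\<phi> n) (\<phi> n) $$ (p, q) * c q)"
    then show thesis by (rule that)
  qed
  obtain Er where Er: "\<And>n. Er n \<in> P.events" "(\<lambda>n. P.prob (Er n)) \<longlonglongrightarrow> 1" "Er 0 = {}"
    "\<And>n \<omega> c. \<omega> \<in> Er n \<Longrightarrow> \<epsilon>r * (\<Sum>j<kr n. (c j)\<^sup>2)
      \<le> (\<Sum>p<kr n. \<Sum>q<kr n. c p * tdmat T n (\<lambda>i t. Y i t \<omega>) \<beta> (kr n) (r n) $$ (p, q) * c q)"
  proof (rule P.tdmat_coercive_whp[of r kr br \<beta> cr, OF r_meas br(2,1) \<beta> cr A2_v(2)], fold \<epsilon>r_def)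
    fix E assume "\<And>n. E n \<in> P.events" "(\<lambda>n. P.prob (E n)) \<longlonglongrightarrow> 1" "E 0 = {}"
      "\<And>n \<omega> c. \<omega> \<in> E n \<Longrightarrow> \<epsilon>r * (\<Sum>j<kr n. (c j)\<^sup>2)
        \<le> (\<Sum>p<kr n. \<Sum>q<kr n. c p * tdmat T n (\<lambda>i t. Y i t \<omega>) \<beta> (kr n) (r n) $$ (p, q) * c q)"
    then show thesis by (rule that)
  qed
  \<comment> \<open>Both matrices must be coercive for the same data; by inclusion-exclusion the
    intersection still has probability tending to one.\<close>
  define E where "E n = E\<phi> n \<inter> Er n" for n
  have "(\<lambda>n. P.prob (E n)) \<longlonglongrightarrow> 1"
  proof (rule tendsto_sandwich[OF _ _ _ tendsto_const])
    have "P.prob (E\<phi> n) + P.prob (Er n) - 1 \<le> P.prob (E n)" for n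
    proof -
      have "P.prob (E\<phi> n \<union> Er n) = P.prob (E\<phi> n) + P.prob (Er n) - P.prob (E n)"
        unfolding E_def by (rule P.finite_measure_Union'[THEN trans])
          (use E\<phi>(1) Er(1) in \<open>auto simp: P.finite_measure_Diff' Int_commute\<close>)
      then show ?thesis using P.prob_le_1[of "E\<phi> n \<union> Er n"] by linarith
    qed
    then show "\<forall>\<^sub>F n in sequentially. P.prob (E\<phi> n) + P.prob (Er n) - 1 \<le> P.prob (E n)" by simp
    have "(\<lambda>n. P.prob (E\<phi> n) + P.prob (Er n) - 1) \<longlonglongrightarrow> 1 + 1 - 1"
      by (intro tendsto_intros E\<phi>(2) Er(2))
    then show "(\<lambda>n. P.prob (E\<phi> n) + P.prob (Er n) - 1) \<longlonglongrightarrow> 1" by simp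
  qed simp
  moreover have "E n \<in> P.events" for n using E\<phi>(1) Er(1) by (simp add: E_def)
  moreover have "let D = (\<lambda>i t. Y i t \<omega>);
                  A\<omega> = tdmat T n D \<beta> (k\<phi> n) (\<phi> n);
                  b\<omega> = vec (k\<phi> n) (\<lambda>p. En T n D (\<lambda>s s'. \<phi> n p s * z s));
                  \<omega>hat = minv A\<omega> *\<^sub>v b\<omega>;
                  ehat = (\<lambda>s. euler_mascheroni - ln (\<eta>hat n \<omega> (fst s) (snd s)));
                  A\<xi> = tdmat T n D \<beta> (kr n) (r n);
                  b\<xi> = vec (kr n) (\<lambda>p. En T n D (\<lambda>s s'. \<beta> * r n p s * ehat s'));
                  \<xi>hat = minv A\<xi> *\<^sub>v b\<xi>
              in invertible_mat A\<omega> \<and> invertible_mat A\<xi> \<and>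
                 (\<forall>w0 \<in> carrier_vec (k\<phi> n).
                    AE \<sigma> in drawM T n.
                      \<forall>j < k\<phi> n. (\<lambda>l. td \<alpha>\<omega> \<beta> (\<lambda>i t. fvec (k\<phi> n) (\<phi> n) (D i t))
                                         (\<lambda>i t. z (D i t)) w0 \<sigma> l $ j) \<longlonglongrightarrow> \<omega>hat $ j) \<and>
                 (\<forall>v0 \<in> carrier_vec (kr n).
                    AE \<sigma> in drawM T n.
                      \<forall>j < kr n. (\<lambda>l. td \<alpha>\<xi> \<beta> (\<lambda>i t. fvec (kr n) (r n) (D i t))
                                         (\<lambda>i t. \<beta> * ehat (D i (Suc t))) v0 \<sigma> l $ j) \<longlonglongrightarrow> \<xi>hat $ j)"
    if \<omega>: "\<omega> \<in> E n" for n \<omega>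
  proof -
    have n: "0 < n" using \<omega> E\<phi>(3) by (cases n) (auto simp: E_def)
    have \<omega>': "\<omega> \<in> E\<phi> n" "\<omega> \<in> Er n" using \<omega> by (auto simp: E_def)
    have inv: "invertible_mat (tdmat T n (\<lambda>i t. Y i t \<omega>) \<beta> (k\<phi> n) (\<phi> n))"
      "invertible_mat (tdmat T n (\<lambda>i t. Y i t \<omega>) \<beta> (kr n) (r n))"
      by (fact minv_right_inverse(1)[OF tdmat_carrier det_nonzero_if_coercive[OF tdmat_carrier \<epsilon>(1) E\<phi>(4)[OF \<omega>'(1)]]]
            minv_right_inverse(1)[OF tdmat_carrier det_nonzero_if_coercive[OF tdmat_carrier \<epsilon>(2) Er(4)[OF \<omega>'(2)]]])+
    \<comment> \<open>With the data fixed, the plug-in term is an ordinary function of the state.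
      The second recursion is then the first with the reward \<open>\<beta> * e\<close> read one
      period later.\<close>
    define e where "e s = euler_mascheroni - ln (\<eta>hat n \<omega> (fst s) (snd s))" for s :: "'a \<times> 'x"
    have e_eq: "(\<lambda>s. euler_mascheroni - ln (\<eta>hat n \<omega> (fst s) (snd s))) = e" by (simp add: e_def fun_eq_iff)
    have b\<phi>_eq: "vec (k\<phi> n) (\<lambda>p. En T n (\<lambda>i t. Y i t \<omega>) (\<lambda>s s'. \<phi> n p s * z s)) =
        vec (k\<phi> n) (\<lambda>p. (\<Sum>s\<in>idxset T n. \<phi> n p (Y (fst s) (snd s) \<omega>) * z (Y (fst s) (snd s) \<omega>)) / card (idxset T n))"
      by (simp only: En_eq_average[OF T])
    have br_eq: "vec (kr n) (\<lambda>p. En T n (\<lambda>i t. Y i t \<omega>) (\<lambda>s s'. \<beta> * r n p s * e s')) =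
        vec (kr n) (\<lambda>p. (\<Sum>s\<in>idxset T n. r n p (Y (fst s) (snd s) \<omega>) * (\<beta> * e (Y (fst s) (Suc (snd s)) \<omega>))) / card (idxset T n))"
      by (simp only: En_eq_average[OF T] mult.commute mult.left_commute)
    show ?thesis
      unfolding Let_def e_eq b\<phi>_eq br_eq
      by (intro conjI ballI inv
          td_AE_tendsto[OF n T \<epsilon>(1) E\<phi>(4)[OF \<omega>'(1)] \<alpha>_nonneg(1) \<alpha>\<omega>_sum \<alpha>\<omega>_sq]
          td_AE_tendsto[OF n T \<epsilon>(2) Er(4)[OF \<omega>'(2)] \<alpha>_nonneg(2) \<alpha>\<xi>_sum \<alpha>\<xi>_sq])
  qed
  ultimately show ?thesis by (intro exI[of _ E] conjI allI ballI)
qed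

end
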